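(* There exist $\ell_0\in\mathbb{N}$ and, for each $\ell\ge\ell_0$, an open interval $M^\ell$ depending only on $v_2$, $v_3$ and $\ell$, with $\mu^{\rm us}_\ell\in M^\ell$, such that for all $\mu\in M^\ell$ there is a unique pair of bond lengths $(\lambda_1^\mu,\lambda_2^\mu)$ such that $\mathcal{F}_{\lambda_1^\mu,\lambda_2^\mu,\mu}$ is a solution of the minimization problem $$E_{\rm min}(\mu)=\min\big\{E(\mathcal{F}_{\lambda_1,\lambda_2,\mu})\ :\ \mathcal{F}_{\lambda_1,\lambda_2,\mu}\in\mathscr{F}(\mu),\ \lambda_1,\lambda_2\in(0.9,1.1)\big\}.$$
   Context: Potentials: $v_2:(0,\infty)\to[-1,\infty)$ is smooth, attains its minimum value only at $1$, $v_2(1)=-1$, $v_2''(1)>0$, and $v_2(r)=0$ for $r\ge1.1$. $v_3:[0,2\pi]\to[0,\infty)$ is smooth, $v_3(\alpha)=v_3(2\pi-\alpha)$, its minimum value $0$ is attained only at $2\pi/3$ and $4\pi/3$, and $v_3''(2\pi/3)>0$. Energy: with $e_1=(1,0,0)$, a nanotube is a periodic configuration $\mathcal{C}=C_n+Le_1\mathbb{Z}$, identified with $(C_n,L)$, where $L>0$ and $C_n=\{x_1,\dots,x_n\}\subset\mathbb{R}^3$ is the $n$-cell, $x_i\cdot e_1\in[0,L)$. Put $|x_i-x_j|_L=\min_{t\in\{-1,0,1\}}|x_i-x_j+Lte_1|$, $\mathcal{N}=\{(i,j): i\ne j,\ |x_i-x_j|_L<1.1\}$ (bonded pairs), $\mathcal{T}=\{(i,j,k):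 i\neq k,\ (i,j)\in\mathcal{N},\ (j,k)\in\mathcal{N}\}$, and let $\alpha_{ijk}\in[0,\pi]$ be the angle formed by $x_i-x_j$ and $x_k-x_j$ (taking the nearest periodic images). Then $$E(\mathcal{C})=E(C_n,L)=\tfrac12\sum_{(i,j)\in\mathcal{N}}v_2(|x_i-x_j|_L)+\tfrac12\sum_{(i,j,k)\in\mathcal{T}}v_3(\alpha_{ijk}).$$ Zigzag nanotubes: for an integer $\ell>3$ and $\mu\in(2.6,3.1)$, $\mathscr{F}(\mu)$ is the family of configurations that coincide, up to isometries, with the set of points $$x_{i,k}^{j,l}=\Big(k(\lambda_1+\sigma)+j(2\sigma+2\lambda_1)+l(2\sigma+\lambda_1),\ \rho\cos\tfrac{\pi(2i+k)}{\ell},\ \rho\sin\tfrac{\pi(2i+k)}{\ell}\Big),$$ $i=1,\dots,\ell$, $j\in\mathbb{Z}$, $k,l\in\{0,1\}$, for some $\lambda_1,\lambda_2,\sigma\in(0,\mu/2)$ and $\rho\in(0,\mu/(4\sin(\pi/(2\ell))))$ with $2\sigma+2\lambda_1=\mu$ and $\sigma^2+4\rho^2\sin^2(\pi/(2\ell))=\lambda_2^2$. The configuration is determined by $\lambda_1,\lambda_2,\mu$ and denoted $\mathcal{F}_{\lambda_1,\lambda_2,\mu}$; for $\lambda_1,\lambda_2\in(0.9,1.1)$ each atom has exactly three bonds, one of length $\lambda_1$ (parallel to $e_1$) and two of length $\lambda_2$. Here $m\in\mathbb{N}$ is an arbitrary fixed number of minimal periods: $\mathcal{F}_{\lambda_1,\lambda_2,\mu}$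 is identified with $(F_n,L^\mu_m)$, $L^\mu_m=m\mu$, $n=4m\ell$, and its energy is $E(F_n,L_m^\mu)$. Unstretched period: $\gamma_\ell=\pi(1-1/\ell)$, $\beta(\alpha,\gamma)=2\arcsin(\sin\alpha\sin(\gamma/2))$. Let $\alpha^{\rm ru}=2\pi/3$ and let $\alpha^{\rm ch}_\ell$ be the unique solution of $\beta(\alpha,\gamma_\ell)=\alpha$ in $(\arccos(-0.4),\arccos(-0.6))$. It is known that there are an open interval $A$ and an integer, depending only on $v_3$, such that for all larger $\ell$ there is a unique $\alpha^{\rm us}_\ell\in A$ minimizing $\alpha\mapsto E(\mathcal{F}_{1,1,2(1-\cos\alpha)})$ over $A$ (equivalently $\alpha\mapsto 2v_3(\alpha)+v_3(\beta(\alpha,\gamma_\ell))$), and $\alpha^{\rm us}_\ell\in(\alpha^{\rm ch}_\ell,\alpha^{\rm ru})\subset A$. Set $\mu^{\rm us}_\ell=2-2\cos\alpha^{\rm us}_\ell$. *)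

theory Defs
  imports "HOL-Analysis.Analysis"
begin

subsection \<open>Potentials\<close>

text \<open>
  Smoothness on an interval, with one-sided derivatives at those endpoints that belong to it:
  \<open>D n\<close> is the \<open>n\<close>-th derivative of \<open>f\<close>.
\<close>

definition smooth_on :: "real set \<Rightarrow> (real \<Rightarrow> real) \<Rightarrow> bool" where
  "smooth_on S f \<longleftrightarrow>
     (\<exists>D :: nat \<Rightarrow> real \<Rightarrow> real. (\<forall>x\<in>S. D 0 x = f x) \<and>
        (\<forall>n. \<forall>x\<in>S. (D n has_real_derivative D (Suc n) x) (at x within S)))"

text \<open>
  The potentials are total functions on the reals; only their values on \<open>(0,\<infty>)\<close>
  and on \<open>[0,2\<pi>]\<close> respectively are constrained.
\<close>

definition two_body_potential :: "(real \<Rightarrow> real) \<Rightarrow> bool" where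
  "two_body_potential v2 \<longleftrightarrow>
     smooth_on {0<..} v2 \<and>
     v2 1 = -1 \<and> (\<forall>r>0. r \<noteq> 1 \<longrightarrow> v2 r > -1) \<and>
     deriv (deriv v2) 1 > 0 \<and>
     (\<forall>r\<ge>1.1. v2 r = 0)"

definition three_body_potential :: "(real \<Rightarrow> real) \<Rightarrow> bool" where
  "three_body_potential v3 \<longleftrightarrow>
     smooth_on {0..2*pi} v3 \<and>
     (\<forall>\<alpha>\<in>{0..2*pi}. v3 \<alpha> \<ge> 0) \<and>
     (\<forall>\<alpha>\<in>{0..2*pi}. v3 \<alpha> = v3 (2*pi - \<alpha>)) \<and>
     (\<forall>\<alpha>\<in>{0..2*pi}. v3 \<alpha> = 0 \<longleftrightarrow> \<alpha> = 2*pi/3 \<or> \<alpha> = 4*pi/3) \<and>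
     deriv (deriv v3) (2*pi/3) > 0"

subsection \<open>Energy of a periodic configuration\<close>

abbreviation e1 :: "real^3" where
  "e1 \<equiv> axis 1 1"

definition period_images :: "real \<Rightarrow> real^3 \<Rightarrow> real^3 \<Rightarrow> (real^3) set" where
  "period_images L x y = (\<lambda>t. x - y + (L * t) *\<^sub>R e1) ` {-1, 0, 1}"

definition pdist :: "real \<Rightarrow> real^3 \<Rightarrow> real^3 \<Rightarrow> real" where
  "pdist L x y = Min (norm ` period_images L x y)"

text \<open>
  The vector from \<open>y\<close> to the periodic image of \<open>x\<close> nearest to it. For bonded points the
  nearest image is unique as soon as \<open>L \<ge> 2.2\<close>.
\<close>

definition pdiff :: "real \<Rightarrow> real^3 \<Rightarrow> real^3 \<Rightarrow> real^3" where
  "pdiff L x y = arg_min_on norm (period_images L x y)"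

definition bond_angle :: "real \<Rightarrow> real^3 \<Rightarrow> real^3 \<Rightarrow> real^3 \<Rightarrow> real" where
  "bond_angle L x y z =
     arccos (pdiff L x y \<bullet> pdiff L z y / (norm (pdiff L x y) * norm (pdiff L z y)))"

definition bonds :: "(real^3) set \<Rightarrow> real \<Rightarrow> ((real^3) \<times> (real^3)) set" where
  "bonds C L = {(x, y). x \<in> C \<and> y \<in> C \<and> x \<noteq> y \<and> pdist L x y < 1.1}"

definition bond_triples :: "(real^3) set \<Rightarrow> real \<Rightarrow> ((real^3) \<times> (real^3) \<times> (real^3)) set" where
  "bond_triples C L = {(x, y, z). x \<noteq> z \<and> (x, y) \<in> bonds C L \<and> (y, z) \<in> bonds C L}"

text \<open>
  Here \<open>C\<close> is the \<open>n\<close>-cell, as a set of points: the indices of its points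
  are replaced by the points themselves.
\<close>

definition energy ::
  "(real \<Rightarrow> real) \<Rightarrow> (real \<Rightarrow> real) \<Rightarrow> (real^3) set \<Rightarrow> real \<Rightarrow> real" where
  "energy v2 v3 C L =
     (\<Sum>(x, y)\<in>bonds C L. v2 (pdist L x y)) / 2 +
     (\<Sum>(x, y, z)\<in>bond_triples C L. v3 (bond_angle L x y z)) / 2"

definition cell :: "(real^3) set \<Rightarrow> real \<Rightarrow> (real^3) set" where
  "cell C L = {x \<in> C. 0 \<le> x \<bullet> e1 \<and> x \<bullet> e1 < L}"

subsection \<open>Zigzag nanotubes\<close>

definition zigzag_point ::
  "nat \<Rightarrow> real \<Rightarrow> real \<Rightarrow> real \<Rightarrow> nat \<Rightarrow> int \<Rightarrow> nat \<Rightarrow> nat \<Rightarrow> real^3" where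
  "zigzag_point ell lam1 \<sigma> \<rho> i j k l =
     vector [real k * (lam1 + \<sigma>) + of_int j * (2*\<sigma> + 2*lam1) + real l * (2*\<sigma> + lam1),
             \<rho> * cos (pi * (2 * real i + real k) / real ell),
             \<rho> * sin (pi * (2 * real i + real k) / real ell)]"

definition zigzag_tube :: "nat \<Rightarrow> real \<Rightarrow> real \<Rightarrow> real \<Rightarrow> (real^3) set" where
  "zigzag_tube ell lam1 \<sigma> \<rho> =
     {zigzag_point ell lam1 \<sigma> \<rho> i j k l | i j k l. i \<in> {1..ell} \<and> k \<in> {0, 1} \<and> l \<in> {0, 1}}"

definition zigzag_parameters ::
  "nat \<Rightarrow> real \<Rightarrow> real \<Rightarrow> real \<Rightarrow> real \<Rightarrow> real \<Rightarrow> bool" where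
  "zigzag_parameters ell \<mu> lam1 lam2 \<sigma> \<rho> \<longleftrightarrow>
     lam1 \<in> {0<..<\<mu>/2} \<and> lam2 \<in> {0<..<\<mu>/2} \<and> \<sigma> \<in> {0<..<\<mu>/2} \<and>
     \<rho> \<in> {0<..<\<mu> / (4 * sin (pi / (2 * real ell)))} \<and>
     2*\<sigma> + 2*lam1 = \<mu> \<and>
     \<sigma>\<^sup>2 + 4 * \<rho>\<^sup>2 * (sin (pi / (2 * real ell)))\<^sup>2 = lam2\<^sup>2"

definition zigzag_family :: "nat \<Rightarrow> real \<Rightarrow> (real^3) set set" where
  "zigzag_family ell \<mu> =
     {C. \<exists>lam1 lam2 \<sigma> \<rho> (f :: real^3 \<Rightarrow> real^3).
           zigzag_parameters ell \<mu> lam1 lam2 \<sigma> \<rho> \<and>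
           (\<forall>x y. dist (f x) (f y) = dist x y) \<and>
           C = f ` zigzag_tube ell lam1 \<sigma> \<rho>}"

text \<open>
  The representative with axis along \<open>e1\<close> of the configuration determined by
  \<open>lam1\<close>, \<open>lam2\<close>, \<open>\<mu>\<close>: the two equations in
  \<^const>\<open>zigzag_parameters\<close> are solved for \<open>\<sigma>\<close> and for \<open>\<rho> > 0\<close>.
\<close>

definition zigzag :: "nat \<Rightarrow> real \<Rightarrow> real \<Rightarrow> real \<Rightarrow> (real^3) set" where
  "zigzag ell lam1 lam2 \<mu> =
     (let \<sigma> = \<mu>/2 - lam1;
          \<rho> = sqrt (lam2\<^sup>2 - \<sigma>\<^sup>2) / (2 * sin (pi / (2 * real ell)))
      in zigzag_tube ell lam1 \<sigma> \<rho>)"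

definition zigzag_energy ::
  "(real \<Rightarrow> real) \<Rightarrow> (real \<Rightarrow> real) \<Rightarrow> nat \<Rightarrow> nat \<Rightarrow> real \<Rightarrow> real \<Rightarrow> real \<Rightarrow> real" where
  "zigzag_energy v2 v3 m ell lam1 lam2 \<mu> =
     energy v2 v3 (cell (zigzag ell lam1 lam2 \<mu>) (real m * \<mu>)) (real m * \<mu>)"

definition Emin_feasible :: "nat \<Rightarrow> real \<Rightarrow> real \<times> real \<Rightarrow> bool" where
  "Emin_feasible ell \<mu> = (\<lambda>(lam1, lam2).
     zigzag ell lam1 lam2 \<mu> \<in> zigzag_family ell \<mu> \<and>
     lam1 \<in> {0.9<..<1.1} \<and> lam2 \<in> {0.9<..<1.1})"

definition Emin_solution ::
  "(real \<Rightarrow> real) \<Rightarrow> (real \<Rightarrow> real) \<Rightarrow> nat \<Rightarrow> nat \<Rightarrow> real \<Rightarrow> real \<times> real \<Rightarrow> bool" where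
  "Emin_solution v2 v3 m ell \<mu> =
     is_arg_min (\<lambda>(lam1, lam2). zigzag_energy v2 v3 m ell lam1 lam2 \<mu>) (Emin_feasible ell \<mu>)"

subsection \<open>The unstretched period\<close>

definition tube_angle :: "nat \<Rightarrow> real" where
  "tube_angle ell = pi * (1 - 1 / real ell)"

definition beta :: "real \<Rightarrow> real \<Rightarrow> real" where
  "beta \<alpha> \<gamma> = 2 * arcsin (sin \<alpha> * sin (\<gamma> / 2))"

definition alpha_ru :: real where
  "alpha_ru = 2*pi/3"

definition alpha_ch :: "nat \<Rightarrow> real" where
  "alpha_ch ell =
     (THE \<alpha>. \<alpha> \<in> {arccos (-0.4)<..<arccos (-0.6)} \<and> beta \<alpha> (tube_angle ell) = \<alpha>)"

definition unstretched_angle ::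
  "(real \<Rightarrow> real) \<Rightarrow> (real \<Rightarrow> real) \<Rightarrow> nat \<Rightarrow> real set \<Rightarrow> nat \<Rightarrow> real \<Rightarrow> bool" where
  "unstretched_angle v2 v3 m A ell =
     is_arg_min (\<lambda>\<alpha>. zigzag_energy v2 v3 m ell 1 1 (2 * (1 - cos \<alpha>))) (\<lambda>\<alpha>. \<alpha> \<in> A)"

definition alpha_us ::
  "(real \<Rightarrow> real) \<Rightarrow> (real \<Rightarrow> real) \<Rightarrow> nat \<Rightarrow> real set \<Rightarrow> nat \<Rightarrow> real" where
  "alpha_us v2 v3 m A ell = (THE \<alpha>. unstretched_angle v2 v3 m A ell \<alpha>)"

definition mu_us ::
  "(real \<Rightarrow> real) \<Rightarrow> (real \<Rightarrow> real) \<Rightarrow> nat \<Rightarrow> real set \<Rightarrow> nat \<Rightarrow> real" where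
  "mu_us v2 v3 m A ell = 2 - 2 * cos (alpha_us v2 v3 m A ell)"

text \<open>
  The known properties of the interval \<open>A\<close> and of the threshold \<open>N\<close> with respect to which
  the unstretched angle, hence the unstretched period, is defined. Neither \<open>A\<close> nor \<open>N\<close>
  depends on \<open>ell\<close> or on the number \<open>m\<close> of minimal periods.
\<close>

definition unstretched_interval ::
  "(real \<Rightarrow> real) \<Rightarrow> (real \<Rightarrow> real) \<Rightarrow> real set \<Rightarrow> nat \<Rightarrow> bool" where
  "unstretched_interval v2 v3 A N \<longleftrightarrow>
     open A \<and> is_interval A \<and>
     (\<forall>m ell. 1 \<le> m \<longrightarrow> 3 < ell \<longrightarrow> N < ell \<longrightarrow>
        (\<exists>!\<alpha>. unstretched_angle v2 v3 m A ell \<alpha>) \<and>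
        alpha_us v2 v3 m A ell \<in> {alpha_ch ell<..<alpha_ru} \<and>
        {alpha_ch ell<..<alpha_ru} \<subseteq> A)"

end

theory Submission
  imports Defs "HOL-Real_Asymp.Real_Asymp"
begin

text \<open>
  For bond lengths in \<open>(0.9,1.1)\<close>, periods in \<open>(2.6,3.1)\<close> and \<open>ell \<ge> 4\<close>, every atom of a
  zigzag tube has exactly one bond of length \<open>a\<close>, parallel to the axis, and two bonds of
  length \<open>b\<close>. Therefore the energy is a positive constant times
  \<open>v2(a) + 2 v2(b) + 4 V(u) + 2 V(1 - 2K(1 - u\<^sup>2))\<close>, where \<open>V(x) = v3(arccos x)\<close>,
  \<open>u = (a - \<mu>/2)/b\<close> and \<open>K = cos\<^sup>2(\<pi>/(2 ell))\<close> (lemma \<open>zigzag_energy_eq\<close>). The number of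
  periods only enters the constant, and all \<open>a\<close>, \<open>b\<close> in the range are feasible, so a problem
  in two real variables with parameters \<open>\<mu>\<close> and \<open>K\<close> remains.

  At \<open>\<mu> = 3\<close>, \<open>K = 1\<close> the point \<open>a = b = 1\<close> minimizes every term: both cosines are
  \<open>-1/2\<close>. For \<open>(\<mu>,K)\<close> near \<open>(3,1)\<close> the energy at \<open>a = b = 1\<close> is still below
  its values outside a small square around \<open>(1,1)\<close>, by the strict minimum of \<open>v2\<close> at \<open>1\<close> and
  \<open>v3 \<ge> 0\<close>; so a minimizer exists and lies in the square. In the square the energy is strictly
  convex, since \<open>v2''(1) > 0\<close>, \<open>V'(-1/2) = 0\<close> and \<open>V''(-1/2) > 0\<close>
  (\<open>atom_energy_midpoint_less\<close>); so the minimizer is unique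
  (\<open>atom_energy_unique_minimizer\<close>).

  Hence an interval \<open>(3 - \<delta>, 3 + \<delta>)\<close>, the same for all large \<open>ell\<close> and for all numbers of
  periods, has the required property. It contains the unstretched period, because the
  unstretched angle lies between \<open>alpha_ch ell\<close> and \<open>2\<pi>/3\<close>, and
  \<open>cos (alpha_ch ell) = 1/(2K) - 1\<close> tends to \<open>-1/2\<close> (\<open>mu_us_bounds\<close>).
\<close>

section \<open>Bonds of periodic configurations\<close>

text \<open>
  The bonds at a point \<open>y\<close> of a configuration \<open>T\<close> in the whole space, as displacements from
  \<open>y\<close>. For a periodic \<open>T\<close> they replace the bonds of the cell, where distances are taken
  between nearest images.
\<close>

definition nbr_vectors :: "(real^3) set \<Rightarrow> real^3 \<Rightarrow> (real^3) set" where
  "nbr_vectors T y = {d. d \<noteq> 0 \<and> y + d \<in> T \<and> norm d < 1.1}"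

lemma inner_e1: "x \<bullet> e1 = x $ 1"
  by (simp add: inner_axis)

lemma pdiff_in_period_images: "pdiff L x y \<in> period_images L x y"
  unfolding pdiff_def by (rule arg_min_if_finite) (auto simp: period_images_def)

lemma norm_pdiff: "norm (pdiff L x y) = pdist L x y"
proof -
  have fin: "finite (period_images L x y)" "period_images L x y \<noteq> {}"
    by (auto simp: period_images_def)
  show ?thesis
    unfolding pdist_def
  proof (rule Min_eqI [symmetric])
    fix s assume "s \<in> norm ` period_images L x y"
    then show "norm (pdiff L x y) \<le> s"
      using arg_min_if_finite(2) [OF fin, of norm] by (auto simp: pdiff_def not_less)
  qed (use fin pdiff_in_period_images in auto)
qed

lemma pdist_le: "d \<in> period_images L x y \<Longrightarrow> pdist L x y \<le> norm d"
  unfolding pdist_def by (rule Min_le) (auto simp: period_images_def)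

lemma pdist_commute: "pdist L x y = pdist L y x"
proof -
  have "period_images L y x = uminus ` period_images L x y"
    by (auto simp: period_images_def)
  then have "norm ` period_images L y x = norm ` period_images L x y"
    by (simp add: image_image)
  then show ?thesis by (simp add: pdist_def)
qed

lemma bonds_commute: "(x, y) \<in> bonds C L \<longleftrightarrow> (y, x) \<in> bonds C L"
  by (auto simp: bonds_def pdist_commute)

lemma period_shift_unique:
  fixes s t :: real
  assumes "s \<in> {-1, 0, 1}" "t \<in> {-1, 0, 1}" "\<bar>L * s - L * t\<bar> < L"
  shows "s = t"
  using assms by auto

text \<open>
  Two images of a point both closer than \<open>1.1\<close> to \<open>y\<close> would differ by at least
  \<open>L \<ge> 2.2\<close>. Hence a bond in the cell has a single short image, and it is the nearest one.
\<close>

lemma bij_betw_pdiff: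
  assumes per: "\<And>x t. x \<in> T \<Longrightarrow> t \<in> {-1, 0, 1} \<Longrightarrow> x + (L * t) *\<^sub>R e1 \<in> T"
    and L: "2.2 \<le> L" and y: "y \<in> cell T L"
  shows "bij_betw (\<lambda>x. pdiff L x y) {x. (x, y) \<in> bonds (cell T L) L} (nbr_vectors T y)"
proof (rule bij_betw_imageI)
  note cell_range = cell_def inner_e1
  have cell_unique: "x = x' \<and> t = t'"
    if "x \<in> cell T L" "x' \<in> cell T L" "t \<in> {-1, 0, 1}" "t' \<in> {-1, 0, 1}"
      and eq: "x + (L * t) *\<^sub>R e1 = x' + (L * t') *\<^sub>R e1" for x x' t t'
  proof -
    have "x $ 1 + L * t = x' $ 1 + L * t'"
      using arg_cong [OF eq, of "\<lambda>v. v $ 1"] by simp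
    moreover have "\<bar>x $ 1 - x' $ 1\<bar> < L"
      using that(1,2) by (auto simp: cell_range)
    ultimately have "\<bar>L * t - L * t'\<bar> < L" by linarith
    then have "t = t'" using that period_shift_unique by blast
    then show ?thesis using eq by simp
  qed
  have in_T: "x \<in> T" if "x \<in> cell T L" for x using that by (simp add: cell_def)
  show "inj_on (\<lambda>x. pdiff L x y) {x. (x, y) \<in> bonds (cell T L) L}"
  proof (rule inj_onI)
    fix x x' assume x: "x \<in> {x. (x, y) \<in> bonds (cell T L) L}"
      and x': "x' \<in> {x. (x, y) \<in> bonds (cell T L) L}" and eq: "pdiff L x y = pdiff L x' y"
    obtain t where t: "t \<in> {-1, 0, 1}" "pdiff L x y = x - y + (L * t) *\<^sub>R e1"
      using pdiff_in_period_images [of L x y] unfolding period_images_def by blast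
    obtain t' where t': "t' \<in> {-1, 0, 1}" "pdiff L x' y = x' - y + (L * t') *\<^sub>R e1"
      using pdiff_in_period_images [of L x' y] unfolding period_images_def by blast
    have "x + (L * t) *\<^sub>R e1 = x' + (L * t') *\<^sub>R e1"
      using eq t t' by (simp add: algebra_simps)
    then show "x = x'" using cell_unique [of x x' t t'] x x' t t' by (auto simp: bonds_def)
  qed
  show "(\<lambda>x. pdiff L x y) ` {x. (x, y) \<in> bonds (cell T L) L} = nbr_vectors T y"
  proof (intro equalityI subsetI)
    fix d assume "d \<in> (\<lambda>x. pdiff L x y) ` {x. (x, y) \<in> bonds (cell T L) L}"
    then obtain x where x: "(x, y) \<in> bonds (cell T L) L" and d: "d = pdiff L x y" by blast
    obtain t where t: "t \<in> {-1, 0, 1}" "d = x - y + (L * t) *\<^sub>R e1"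
      using pdiff_in_period_images [of L x y] d unfolding period_images_def by blast
    have "d \<noteq> 0"
    proof
      assume "d = 0"
      then have "x + (L * t) *\<^sub>R e1 = y + (L * 0) *\<^sub>R e1" using t by (simp add: algebra_simps)
      then show False using cell_unique [of x y t 0] x y t by (auto simp: bonds_def)
    qed
    moreover have "y + d \<in> T"
      using per [of x t] in_T x t by (auto simp: bonds_def)
    ultimately show "d \<in> nbr_vectors T y"
      using x d by (simp add: nbr_vectors_def bonds_def norm_pdiff)
  next
    fix d assume d: "d \<in> nbr_vectors T y"
    \<comment> \<open>As the axial component of a bond is less than \<open>L\<close>, one shift by \<open>L\<close> at most
      leads back into the cell.\<close>
    have d1: "\<bar>d $ 1\<bar> < 1.1" using d component_le_norm_cart [of d 1] by (simp add: nbr_vectors_def)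
    have y1: "0 \<le> y $ 1" "y $ 1 < L" using y by (auto simp: cell_range)
    obtain t :: real where t: "t \<in> {-1, 0, 1}" "0 \<le> y $ 1 + d $ 1 - L * t" "y $ 1 + d $ 1 - L * t < L"
    proof -
      consider "y $ 1 + d $ 1 < 0" | "0 \<le> y $ 1 + d $ 1" "y $ 1 + d $ 1 < L" | "L \<le> y $ 1 + d $ 1"
        by linarith
      then show thesis
        by cases (use d1 y1 L in \<open>auto intro: that [of "-1"] that [of 0] that [of 1]\<close>)
    qed
    define x where "x = y + d - (L * t) *\<^sub>R e1"
    have "y + d + (L * (- t)) *\<^sub>R e1 \<in> T"
      by (rule per) (use d t(1) in \<open>auto simp: nbr_vectors_def\<close>)
    then have "x \<in> T" by (simp add: x_def)
    moreover have "x $ 1 = y $ 1 + d $ 1 - L * t" by (simp add: x_def)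
    ultimately have x: "x \<in> cell T L" using t by (simp add: cell_range)
    have d_eq: "d = x - y + (L * t) *\<^sub>R e1" by (simp add: x_def)
    then have img: "d \<in> period_images L x y" using t by (auto simp: period_images_def)
    have "pdist L x y < 1.1" using pdist_le [OF img] d by (simp add: nbr_vectors_def)
    moreover have "x \<noteq> y"
    proof
      assume "x = y"
      then have "d = (L * t) *\<^sub>R e1" using d_eq by simp
      then have "d \<noteq> 0" "\<bar>L * t\<bar> < 1.1" using d by (auto simp: nbr_vectors_def)
      then show False using t(1) L \<open>d = (L * t) *\<^sub>R e1\<close> by auto
    qed
    ultimately have bond: "(x, y) \<in> bonds (cell T L) L" using x y by (simp add: bonds_def)
    obtain s where s: "s \<in> {-1, 0, 1}" "pdiff L x y = x - y + (L * s) *\<^sub>R e1"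
      using pdiff_in_period_images [of L x y] unfolding period_images_def by blast
    have "pdiff L x y - d = (L * s - L * t) *\<^sub>R e1"
      using s(2) d_eq by (metis add_diff_cancel_left scaleR_diff_left)
    then have "norm (pdiff L x y - d) = \<bar>L * s - L * t\<bar>" by simp
    moreover have "norm (pdiff L x y - d) < 2.2"
      using norm_triangle_ineq4 [of "pdiff L x y" d] d \<open>pdist L x y < 1.1\<close>
      by (simp add: norm_pdiff nbr_vectors_def)
    ultimately have "s = t" using period_shift_unique [of s t L] s t L by simp
    then have "pdiff L x y = d" using s d_eq by simp
    then show "d \<in> (\<lambda>x. pdiff L x y) ` {x. (x, y) \<in> bonds (cell T L) L}" using bond by blast
  qed
qed

text \<open>The cosine of the angle between two bonds.\<close>

definition cos_angle :: "real^3 \<Rightarrow> real^3 \<Rightarrow> real" where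
  "cos_angle d e = d \<bullet> e / (norm d * norm e)"

lemma energy_eq_sum_over_atoms:
  assumes per: "\<And>x t. x \<in> T \<Longrightarrow> t \<in> {-1, 0, 1} \<Longrightarrow> x + (L * t) *\<^sub>R e1 \<in> T"
    and L: "2.2 \<le> L" and fin: "finite (cell T L)"
  shows "energy v2 v3 (cell T L) L =
    (\<Sum>y\<in>cell T L. (\<Sum>d\<in>nbr_vectors T y. v2 (norm d)) +
       (\<Sum>d\<in>nbr_vectors T y. \<Sum>e\<in>nbr_vectors T y - {d}. v3 (arccos (cos_angle d e)))) / 2"
proof -
  define C where "C = cell T L"
  define B where "B y = {x. (x, y) \<in> bonds C L}" for y
  have finC: "finite C" using fin by (simp add: C_def)
  have finB: "finite (B y)" for y
    by (rule finite_subset [OF _ finC]) (auto simp: B_def bonds_def)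
  have bij: "bij_betw (\<lambda>x. pdiff L x y) (B y) (nbr_vectors T y)" if "y \<in> C" for y
    using bij_betw_pdiff [OF per L, of y] that by (simp add: B_def C_def)
  have two: "(\<Sum>(x, y)\<in>bonds C L. v2 (pdist L x y)) =
      (\<Sum>y\<in>C. \<Sum>d\<in>nbr_vectors T y. v2 (norm d))"
  proof -
    have "(\<Sum>(x, y)\<in>bonds C L. v2 (pdist L x y)) =
        (\<Sum>(y, x)\<in>Sigma C B. v2 (pdist L x y))"
      by (rule sum.reindex_bij_witness [where i = "\<lambda>(y, x). (x, y)" and j = "\<lambda>(x, y). (y, x)"])
        (auto simp: B_def bonds_def)
    also have "\<dots> = (\<Sum>y\<in>C. \<Sum>x\<in>B y. v2 (norm (pdiff L x y)))"
      by (subst sum.Sigma) (use finC finB in \<open>auto simp: norm_pdiff\<close>)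
    also have "\<dots> = (\<Sum>y\<in>C. \<Sum>d\<in>nbr_vectors T y. v2 (norm d))"
      by (intro sum.cong refl sum.reindex_bij_betw bij)
    finally show ?thesis .
  qed
  have three: "(\<Sum>(x, y, z)\<in>bond_triples C L. v3 (bond_angle L x y z)) =
      (\<Sum>y\<in>C. \<Sum>d\<in>nbr_vectors T y. \<Sum>e\<in>nbr_vectors T y - {d}. v3 (arccos (cos_angle d e)))"
  proof -
    have "(\<Sum>(x, y, z)\<in>bond_triples C L. v3 (bond_angle L x y z)) =
        (\<Sum>(y, x, z)\<in>(SIGMA y:C. SIGMA x:B y. B y - {x}). v3 (bond_angle L x y z))"
      by (rule sum.reindex_bij_witness
          [where i = "\<lambda>(y, x, z). (x, y, z)" and j = "\<lambda>(x, y, z). (y, x, z)"])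
        (auto simp: B_def bond_triples_def bonds_commute [of _ _ C L], auto simp: bonds_def)
    also have "\<dots> = (\<Sum>y\<in>C. \<Sum>x\<in>B y. \<Sum>z\<in>B y - {x}.
        v3 (arccos (cos_angle (pdiff L x y) (pdiff L z y))))"
      by (simp add: sum.Sigma finC finB bond_angle_def cos_angle_def)
    also have "\<dots> = (\<Sum>y\<in>C. \<Sum>x\<in>B y. \<Sum>e\<in>nbr_vectors T y - {pdiff L x y}.
        v3 (arccos (cos_angle (pdiff L x y) e)))"
    proof (rule sum.cong [OF refl], rule sum.cong [OF refl], rule sum.reindex_bij_betw)
      fix y x assume "y \<in> C" and x: "x \<in> B y"
      then have inj: "inj_on (\<lambda>z. pdiff L z y) (B y)" and
        im: "(\<lambda>z. pdiff L z y) ` B y = nbr_vectors T y"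
        using bij by (auto simp: bij_betw_def)
      show "bij_betw (\<lambda>z. pdiff L z y) (B y - {x}) (nbr_vectors T y - {pdiff L x y})"
        using inj_on_image_set_diff [OF inj, of "B y" "{x}"] x im inj
        by (auto simp: bij_betw_def intro: inj_on_subset)
    qed
    also have "\<dots> = (\<Sum>y\<in>C. \<Sum>d\<in>nbr_vectors T y. \<Sum>e\<in>nbr_vectors T y - {d}.
        v3 (arccos (cos_angle d e)))"
      by (intro sum.cong refl sum.reindex_bij_betw
          [where g = "\<lambda>d. \<Sum>e\<in>nbr_vectors T _ - {d}. v3 (arccos (cos_angle d e))"] bij)
    finally show ?thesis .
  qed
  show ?thesis
    unfolding energy_def C_def [symmetric] two three by (simp add: sum.distrib add_divide_distrib)
qed

section \<open>Atoms of the zigzag tube\<close>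

text \<open>
  A simpler indexing of the zigzag tube: \<open>r\<close> counts the half periods \<open>\<sigma> + lam1\<close>, \<open>k\<close>
  is \<open>0\<close> or \<open>1\<close> according to which of the two layers in the half period the atom belongs,
  and \<open>\<pi> q / ell\<close> is the angle around the axis. The atoms of the tube are those for which
  \<open>q\<close> has the parity of \<open>r + k\<close>.
\<close>

definition tube_atom :: "nat \<Rightarrow> real \<Rightarrow> real \<Rightarrow> real \<Rightarrow> int \<Rightarrow> int \<Rightarrow> int \<Rightarrow> real^3" where
  "tube_atom ell lam1 \<sigma> \<rho> r k q =
     vector [of_int r * (\<sigma> + lam1) + of_int k * \<sigma>,
             \<rho> * cos (pi * of_int q / real ell),
             \<rho> * sin (pi * of_int q / real ell)]"

lemma tube_atom_nth [simp]:
  "tube_atom ell lam1 \<sigma> \<rho> r k q $ 1 = of_int r * (\<sigma> + lam1) + of_int k * \<sigma>"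
  "tube_atom ell lam1 \<sigma> \<rho> r k q $ 2 = \<rho> * cos (pi * of_int q / real ell)"
  "tube_atom ell lam1 \<sigma> \<rho> r k q $ 3 = \<rho> * sin (pi * of_int q / real ell)"
  by (simp_all add: tube_atom_def)

lemma same_direction_iff:
  assumes "0 < ell"
  shows "cos (pi * of_int q / real ell) = cos (pi * of_int q' / real ell) \<and>
         sin (pi * of_int q / real ell) = sin (pi * of_int q' / real ell) \<longleftrightarrow>
         2 * int ell dvd q - q'"
proof -
  have "pi * of_int q / real ell = pi * of_int q' / real ell + 2 * pi * of_int n \<longleftrightarrow>
      q - q' = (2 * int ell) * n" for n
  proof -
    have "pi * of_int q / real ell = pi * of_int q' / real ell + 2 * pi * of_int n \<longleftrightarrow>
        pi * (real_of_int q - real_of_int q') = pi * (2 * real ell * of_int n)"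
      using assms by (simp add: field_simps)
    also have "\<dots> \<longleftrightarrow> real_of_int (q - q') = real_of_int (2 * int ell * n)" by simp
    finally show ?thesis by (simp only: of_int_eq_iff)
  qed
  then show ?thesis
    using sin_cos_eq_iff [of "pi * of_int q / real ell" "pi * of_int q' / real ell"]
    unfolding dvd_def by blast
qed

lemma tube_atom_eq_iff:
  assumes ell: "0 < ell" and pos: "0 < \<sigma>" "0 < lam1" "0 < \<rho>"
    and k: "k \<in> {0, 1}" "k' \<in> {0, 1}"
  shows "tube_atom ell lam1 \<sigma> \<rho> r k q = tube_atom ell lam1 \<sigma> \<rho> r' k' q' \<longleftrightarrow>
    r = r' \<and> k = k' \<and> 2 * int ell dvd q - q'"
proof -
  have "of_int r * (\<sigma> + lam1) + of_int k * \<sigma> = of_int r' * (\<sigma> + lam1) + of_int k' * \<sigma> \<longleftrightarrow>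
      r = r' \<and> k = k'"
  proof
    assume "of_int r * (\<sigma> + lam1) + of_int k * \<sigma> = of_int r' * (\<sigma> + lam1) + of_int k' * \<sigma>"
    then have eq: "of_int (r - r') * (\<sigma> + lam1) = of_int (k' - k) * \<sigma>" by (simp add: algebra_simps)
    have "\<bar>of_int (k' - k) * \<sigma>\<bar> < 1 * (\<sigma> + lam1)" using k pos by auto
    moreover have "\<bar>of_int (k' - k) * \<sigma>\<bar> = \<bar>of_int (r - r') :: real\<bar> * (\<sigma> + lam1)"
      unfolding eq [symmetric] abs_mult using pos by simp
    ultimately have "\<bar>of_int (r - r') :: real\<bar> * (\<sigma> + lam1) < 1 * (\<sigma> + lam1)" by simp
    then have "\<bar>of_int (r - r') :: real\<bar> < 1" 
      using mult_less_cancel_right_pos [of "\<sigma> + lam1" "\<bar>of_int (r - r')\<bar>" 1] pos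
      by (simp only: add_pos_pos)
    then have "r = r'" by linarith
    then show "r = r' \<and> k = k'" using eq pos by simp
  qed auto
  then show ?thesis
    using same_direction_iff [OF ell, of q q'] pos by (simp add: vec_eq_iff forall_3)
qed

lemma zigzag_tube_eq:
  assumes ell: "0 < ell"
  shows "zigzag_tube ell lam1 \<sigma> \<rho> =
    {tube_atom ell lam1 \<sigma> \<rho> r k q | r k q. k \<in> {0, 1} \<and> even (q - r - k)}"
proof (intro equalityI subsetI)
  fix x assume "x \<in> zigzag_tube ell lam1 \<sigma> \<rho>"
  then obtain i j k l where x: "x = zigzag_point ell lam1 \<sigma> \<rho> i j k l" and kl: "k \<in> {0, 1}" "l \<in> {0, 1}"
    unfolding zigzag_tube_def by blast
  have "x = tube_atom ell lam1 \<sigma> \<rho> (2 * j + int k + int l) (int l) (2 * int i + int k)"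
    unfolding x zigzag_point_def tube_atom_def by (simp add: algebra_simps)
  moreover have "even ((2 * int i + int k) - (2 * j + int k + int l) - int l)" by simp
  moreover have "int l \<in> {0, 1}" using kl by auto
  ultimately show "x \<in> {tube_atom ell lam1 \<sigma> \<rho> r k q | r k q. k \<in> {0, 1} \<and> even (q - r - k)}"
    by blast
next
  fix x assume "x \<in> {tube_atom ell lam1 \<sigma> \<rho> r k q | r k q. k \<in> {0, 1} \<and> even (q - r - k)}"
  then obtain r k q where x: "x = tube_atom ell lam1 \<sigma> \<rho> r k q" and k: "k \<in> {0, 1}" and ev: "even (q - r - k)"
    by blast
  \<comment> \<open>The angular index \<open>i\<close> has to be brought into \<open>{1..ell}\<close>, whence the shift by one
    around the reduction modulo \<open>ell\<close>.\<close>
  define k' where "k' = nat (q mod 2)"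
  define l where "l = nat k"
  define j where "j = (r - k - q mod 2) div 2"
  define i where "i = nat ((q div 2 - 1) mod int ell + 1)"
  have k'_int: "int k' = q mod 2" and l_int: "int l = k" using k by (auto simp: k'_def l_def)
  have "even (r - k - q mod 2)" using ev by presburger
  then have r_eq: "r = 2 * j + k + q mod 2" unfolding j_def by simp
  have mod_range: "0 \<le> (q div 2 - 1) mod int ell" "(q div 2 - 1) mod int ell < int ell"
    using ell by simp_all
  then have i_int: "int i = (q div 2 - 1) mod int ell + 1" and i: "i \<in> {1..ell}"
    by (auto simp: i_def)
  have "int ell dvd (q div 2 - 1) - (q div 2 - 1) mod int ell" by (rule dvd_minus_mod)
  then have "2 * int ell dvd 2 * ((q div 2 - 1) - (q div 2 - 1) mod int ell)" by (rule mult_dvd_mono [OF dvd_refl])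
  moreover have "2 * ((q div 2 - 1) - (q div 2 - 1) mod int ell) = q - (2 * int i + q mod 2)"
    using mult_div_mod_eq [of 2 q] unfolding i_int by (simp add: algebra_simps)
  ultimately have "2 * int ell dvd q - (2 * int i + q mod 2)" by simp
  note dir = same_direction_iff [OF ell, THEN iffD2, OF this]
  have re: "real_of_int r = 2 * of_int j + real l + real k'" "real_of_int k = real l"
    using r_eq k'_int l_int by (metis of_int_add of_int_mult of_int_numeral of_int_of_nat_eq, metis of_int_of_nat_eq)
  have "real_of_int (2 * int i + q mod 2) = 2 * real i + real k'"
    by (simp flip: k'_int)
  then have "x = zigzag_point ell lam1 \<sigma> \<rho> i j k' l"
    using dir unfolding x zigzag_point_def tube_atom_def re by (simp add: algebra_simps)
  moreover have "k' \<in> {0, 1}" "l \<in> {0, 1}" using k by (auto simp: k'_def l_def)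
  ultimately show "x \<in> zigzag_tube ell lam1 \<sigma> \<rho>" using i unfolding zigzag_tube_def by blast
qed

lemma inner_tube_atom_diff:
  fixes ell
  defines "d \<equiv> \<lambda>q. pi * real_of_int q / real ell"
  shows "(tube_atom ell lam1 \<sigma> \<rho> r1 k1 q1 - tube_atom ell lam1 \<sigma> \<rho> r k q) \<bullet>
         (tube_atom ell lam1 \<sigma> \<rho> r2 k2 q2 - tube_atom ell lam1 \<sigma> \<rho> r k q) =
     (of_int (r1 - r) * (\<sigma> + lam1) + of_int (k1 - k) * \<sigma>) * (of_int (r2 - r) * (\<sigma> + lam1) + of_int (k2 - k) * \<sigma>) +
     \<rho>\<^sup>2 * (cos (d (q1 - q2)) - cos (d (q1 - q)) - cos (d (q2 - q)) + 1)"
proof -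
  have c: "cos (d (p - p')) = cos (d p) * cos (d p') + sin (d p) * sin (d p')" for p p'
    by (simp add: d_def right_diff_distrib diff_divide_distrib cos_diff)
  have "(\<rho> * cos (d q1) - \<rho> * cos (d q)) * (\<rho> * cos (d q2) - \<rho> * cos (d q)) +
        (\<rho> * sin (d q1) - \<rho> * sin (d q)) * (\<rho> * sin (d q2) - \<rho> * sin (d q)) =
        \<rho>\<^sup>2 * (cos (d (q1 - q2)) - cos (d (q1 - q)) - cos (d (q2 - q)) + ((cos (d q))\<^sup>2 + (sin (d q))\<^sup>2))"
    unfolding c power2_eq_square by (simp only: algebra_simps)
  then show ?thesis
    by (simp add: inner_vec_def sum_3 d_def algebra_simps)
qed

lemma norm_tube_atom_diff:
  fixes ell
  shows "(norm (tube_atom ell lam1 \<sigma> \<rho> r1 k1 q1 - tube_atom ell lam1 \<sigma> \<rho> r k q))\<^sup>2 =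
     (of_int (r1 - r) * (\<sigma> + lam1) + of_int (k1 - k) * \<sigma>)\<^sup>2 +
     4 * \<rho>\<^sup>2 * (sin (pi * of_int (q1 - q) / (2 * real ell)))\<^sup>2"
proof -
  have "1 - cos x = 2 * (sin (x/2))\<^sup>2" for x :: real
    using cos_double_sin [of "x/2"] by simp
  from this [of "pi * of_int (q1 - q) / real ell"]
  have "cos (pi * of_int (q1 - q) / real ell) = 1 - 2 * (sin (pi * of_int (q1 - q) / (2 * real ell)))\<^sup>2"
    by (simp add: mult.commute)
  note cos_eq = this
  show ?thesis
    unfolding power2_norm_eq_inner inner_tube_atom_diff cos_eq by (simp add: power2_eq_square algebra_simps)
qed

text \<open>
  The distance around the axis between two angular positions that are neither equal nor
  adjacent is at least that between positions two steps apart, the next ones in a layer.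
\<close>

lemma abs_sin_ge_unless_adjacent:
  fixes n :: int
  assumes ell: "2 \<le> ell"
    and far: "\<not> 2 * int ell dvd n" "\<not> 2 * int ell dvd n - 1" "\<not> 2 * int ell dvd n + 1"
  shows "(sin (pi / real ell))\<^sup>2 \<le> (sin (pi * of_int n / (2 * real ell)))\<^sup>2"
proof -
  define s where "s = n mod (2 * int ell)"
  define c where "c = n div (2 * int ell)"
  have n: "n = 2 * int ell * c + s" by (simp add: s_def c_def)
  have s: "0 \<le> s" "s < 2 * int ell" using ell by (simp_all add: s_def)
  have "s \<noteq> 0" "s \<noteq> 1" using far(1,2) n by auto
  moreover have "s \<noteq> 2 * int ell - 1"
  proof
    assume "s = 2 * int ell - 1"
    then have "n + 1 = 2 * int ell * (c + 1)" using n by (simp add: algebra_simps)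
    then show False using far(3) by simp
  qed
  ultimately have s': "2 \<le> s" "s \<le> 2 * int ell - 2" using s by linarith+
  define x where "x = pi * of_int s / (2 * real ell)"
  define y where "y = pi / real ell"
  have e0: "0 < real ell" using ell by simp
  have "pi * of_int n / (2 * real ell) = x + of_int c * pi"
    using e0 unfolding n x_def by (simp add: field_simps)
  moreover have "(sin (x + of_int c * pi))\<^sup>2 = (sin x)\<^sup>2"
  proof -
    have "sin (of_int c * pi) = 0" by (auto simp: sin_zero_iff_int2)
    moreover from this have "(cos (of_int c * pi))\<^sup>2 = 1"
      using sin_cos_squared_add [of "of_int c * pi"] by simp
    ultimately show ?thesis by (simp add: sin_add power_mult_distrib)
  qed
  moreover have "y \<le> x"
  proof -
    have "pi * 2 \<le> pi * of_int s" using s' by (intro mult_left_mono) auto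
    then show ?thesis using e0 by (simp add: x_def y_def field_simps)
  qed
  moreover have "x \<le> pi - y"
  proof -
    have "of_int s \<le> 2 * real ell - 2" using s'(2) by linarith
    then have "pi * of_int s \<le> pi * (2 * real ell - 2)" by (intro mult_left_mono) auto
    then show ?thesis using e0 by (simp add: x_def y_def field_simps)
  qed
  moreover have y: "0 < y" "y \<le> pi/2" using ell by (auto simp: y_def field_simps)
  moreover have "sin y \<le> sin x"
  proof (cases "x \<le> pi/2")
    case True
    then show ?thesis using \<open>y \<le> x\<close> y by (intro sin_monotone_2pi_le) auto
  next
    case False
    then have "sin y \<le> sin (pi - x)" using \<open>x \<le> pi - y\<close> y by (intro sin_monotone_2pi_le) auto
    then show ?thesis by simp
  qed
  moreover have "0 \<le> sin y" using y by (intro sin_ge_zero) auto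
  ultimately show ?thesis unfolding y_def [symmetric] by (simp add: power_mono)
qed

section \<open>Bonds and energy of the zigzag tube\<close>

text \<open>
  The inequalities on the parameters that make the bond structure of a zigzag tube the
  expected one. The last one bounds the distance of neighbouring atoms within a layer,
  which must not be bonded.
\<close>

locale zigzag_geometry =
  fixes ell :: nat and a b \<sigma> \<rho> :: real
  assumes ell: "2 \<le> ell"
    and a: "0 < a" "a < 1.1" and b: "0 < b" "b < 1.1"
    and \<sigma>: "0 < \<sigma>" and half_period: "1.1 < \<sigma> + a"
    and \<rho>: "0 < \<rho>"
    and bond: "\<sigma>\<^sup>2 + 4 * \<rho>\<^sup>2 * (sin (pi / (2 * real ell)))\<^sup>2 = b\<^sup>2"
    and wide: "1.1\<^sup>2 \<le> 4 * \<rho>\<^sup>2 * (sin (pi / real ell))\<^sup>2"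
begin

abbreviation "T \<equiv> zigzag_tube ell a \<sigma> \<rho>"
abbreviation "P \<equiv> tube_atom ell a \<sigma> \<rho>"

lemma atom_eq_iff:
  "k \<in> {0, 1} \<Longrightarrow> k' \<in> {0, 1} \<Longrightarrow> P r k q = P r' k' q' \<longleftrightarrow> r = r' \<and> k = k' \<and> 2 * int ell dvd q - q'"
  using ell a \<sigma> \<rho> by (intro tube_atom_eq_iff) auto

lemma T_eq: "T = {P r k q | r k q. k \<in> {0, 1} \<and> even (q - r - k)}"
  using ell by (intro zigzag_tube_eq) simp

text \<open>
  The displacements from the atom \<open>P r k q\<close> along the bond of length \<open>a\<close> and, for \<open>s = 1\<close>
  and \<open>s = -1\<close>, along the two bonds of length \<open>b\<close>.
\<close>

definition axial_bond :: "int \<Rightarrow> int \<Rightarrow> int \<Rightarrow> real^3" where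
  "axial_bond r k q = P (r + 2 * k - 1) (1 - k) q - P r k q"

definition skew_bond :: "int \<Rightarrow> int \<Rightarrow> int \<Rightarrow> int \<Rightarrow> real^3" where
  "skew_bond s r k q = P r (1 - k) (q + s) - P r k q"

text \<open>
  The last equation gives the angle between the two bonds of length \<open>b\<close>; it is that of
  \<open>\<beta>(\<alpha>, \<gamma>)\<close>, written with cosines.
\<close>

lemma bond_inner_products:
  assumes k: "k \<in> {0, 1}"
  shows "norm (axial_bond r k q) = a" "norm (skew_bond 1 r k q) = b" "norm (skew_bond (-1) r k q) = b"
    "axial_bond r k q \<bullet> skew_bond 1 r k q = - (a * \<sigma>)"
    "axial_bond r k q \<bullet> skew_bond (-1) r k q = - (a * \<sigma>)"
    "skew_bond 1 r k q \<bullet> skew_bond (-1) r k q =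
       b\<^sup>2 - 2 * (cos (pi / (2 * real ell)))\<^sup>2 * (b\<^sup>2 - \<sigma>\<^sup>2)"
proof -
  define \<phi> where "\<phi> = pi / (2 * real ell)"
  have double: "pi / real ell = 2 * \<phi>" by (simp add: \<phi>_def)
  have x: "of_int (r + 2 * k - 1 - r) * (\<sigma> + a) + of_int (1 - k - k) * \<sigma> = (2 * of_int k - 1) * a"
    "of_int (r - r) * (\<sigma> + a) + of_int (1 - k - k) * \<sigma> = (1 - 2 * of_int k) * \<sigma>"
    using k by (auto simp: algebra_simps)
  have "(norm (axial_bond r k q))\<^sup>2 = a\<^sup>2"
    unfolding axial_bond_def norm_tube_atom_diff x using k by auto
  then show "norm (axial_bond r k q) = a" using a by simp
  have "(norm (skew_bond 1 r k q))\<^sup>2 = b\<^sup>2"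
    unfolding skew_bond_def norm_tube_atom_diff x using k bond by auto
  then show "norm (skew_bond 1 r k q) = b" using b by simp
  have "(norm (skew_bond (-1) r k q))\<^sup>2 = b\<^sup>2"
    unfolding skew_bond_def norm_tube_atom_diff x using k bond by auto
  then show "norm (skew_bond (-1) r k q) = b" using b by simp
  show "axial_bond r k q \<bullet> skew_bond 1 r k q = - (a * \<sigma>)"
    "axial_bond r k q \<bullet> skew_bond (-1) r k q = - (a * \<sigma>)"
    unfolding axial_bond_def skew_bond_def inner_tube_atom_diff x using k by auto
  have c2: "cos (2 * \<phi>) = 1 - 2 * (sin \<phi>)\<^sup>2" by (rule cos_double_sin)
  have c4: "cos (pi * 2 / real ell) = 2 * (cos (2 * \<phi>))\<^sup>2 - 1"
    using cos_double_cos [of "2 * \<phi>"] by (simp add: \<phi>_def mult.commute)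
  have cs: "(cos \<phi>)\<^sup>2 = 1 - (sin \<phi>)\<^sup>2" by (simp add: cos_squared_eq)
  have "skew_bond 1 r k q \<bullet> skew_bond (-1) r k q = \<sigma>\<^sup>2 + \<rho>\<^sup>2 * (cos (pi * 2 / real ell) - cos (2 * \<phi>) - cos (2 * \<phi>) + 1)"
    unfolding skew_bond_def inner_tube_atom_diff x double [symmetric]
    using k by (auto simp: power2_eq_square)
  also have "\<dots> = \<sigma>\<^sup>2 - cos (2 * \<phi>) * (4 * \<rho>\<^sup>2 * (sin \<phi>)\<^sup>2)"
    unfolding c4 c2 by (simp add: power2_eq_square algebra_simps)
  also have "4 * \<rho>\<^sup>2 * (sin \<phi>)\<^sup>2 = b\<^sup>2 - \<sigma>\<^sup>2" using bond by (simp add: \<phi>_def)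
  also have "\<sigma>\<^sup>2 - cos (2 * \<phi>) * (b\<^sup>2 - \<sigma>\<^sup>2) = b\<^sup>2 - 2 * (cos \<phi>)\<^sup>2 * (b\<^sup>2 - \<sigma>\<^sup>2)"
    unfolding c2 cs by (simp add: algebra_simps)
  finally show "skew_bond 1 r k q \<bullet> skew_bond (-1) r k q =
       b\<^sup>2 - 2 * (cos (pi / (2 * real ell)))\<^sup>2 * (b\<^sup>2 - \<sigma>\<^sup>2)"
    by (simp add: \<phi>_def)
qed

lemma bonds_distinct:
  assumes k: "k \<in> {0, 1}"
  shows "axial_bond r k q \<noteq> skew_bond 1 r k q" "axial_bond r k q \<noteq> skew_bond (-1) r k q"
    "skew_bond 1 r k q \<noteq> skew_bond (-1) r k q"
proof -
  have k': "1 - k \<in> {0, 1}" using k by auto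
  have "\<not> 2 * int ell dvd 2" using ell zdvd_imp_le [of "2 * int ell" 2] by auto
  then show "axial_bond r k q \<noteq> skew_bond 1 r k q" "axial_bond r k q \<noteq> skew_bond (-1) r k q"
    "skew_bond 1 r k q \<noteq> skew_bond (-1) r k q"
    using k by (auto simp: axial_bond_def skew_bond_def atom_eq_iff k')
qed

text \<open>
  Every other atom is too far: the distance around the axis leaves only equal or adjacent
  angular positions, the axial distance leaves the own layer and the two next ones, and the
  parity of \<open>q - r - k\<close> decides between equal and adjacent.
\<close>

lemma near_atom_cases:
  assumes k: "k \<in> {0, 1}" "k' \<in> {0, 1}" and ev: "even (q - r - k)" "even (q' - r' - k')"
    and near: "norm (P r' k' q' - P r k q) < 1.1"
  shows "P r' k' q' \<in> {P r k q, P (r + 2 * k - 1) (1 - k) q, P r (1 - k) (q + 1), P r (1 - k) (q - 1)}"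
proof -
  define X where "X = of_int (r' - r) * (\<sigma> + a) + of_int (k' - k) * \<sigma>"
  define s where "s = (sin (pi * of_int (q' - q) / (2 * real ell)))\<^sup>2"
  have "(norm (P r' k' q' - P r k q))\<^sup>2 < 1.1\<^sup>2"
    using near by (intro power_strict_mono) auto
  then have sum: "X\<^sup>2 + 4 * \<rho>\<^sup>2 * s < 1.1\<^sup>2"
    unfolding norm_tube_atom_diff X_def s_def by simp
  have "X\<^sup>2 < 1.1\<^sup>2" using sum \<rho> by (smt (verit) mult_nonneg_nonneg s_def zero_le_power2)
  then have X: "\<bar>X\<bar> < 1.1" by (rule power2_less_imp_less [of "\<bar>X\<bar>", simplified power2_abs]) simp
  have "4 * \<rho>\<^sup>2 * s < 4 * \<rho>\<^sup>2 * (sin (pi / real ell))\<^sup>2"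
    using sum wide zero_le_power2 [of X] by linarith
  then have "s < (sin (pi / real ell))\<^sup>2" using \<rho> by simp
  then have adj: "2 * int ell dvd q' - q \<or> 2 * int ell dvd q' - q - 1 \<or> 2 * int ell dvd q' - q + 1"
    using abs_sin_ge_unless_adjacent [OF ell, of "q' - q"] unfolding s_def by linarith
  have even_if_dvd: "even c" if "2 * int ell dvd c" for c using that by (rule dvd_mult_left)
  have odd_case: "2 * int ell dvd q' - (q + 1) \<or> 2 * int ell dvd q' - (q - 1)" if "odd (q' - q)"
  proof -
    have "\<not> 2 * int ell dvd q' - q" using that even_if_dvd by blast
    then show ?thesis using adj by (simp add: algebra_simps)
  qed
  have even_case: "2 * int ell dvd q' - q" if "even (q' - q)"
    using adj that even_if_dvd [of "q' - q - 1"] even_if_dvd [of "q' - q + 1"] by auto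
  have large: "1.1 < of_int n * (\<sigma> + a)" if "1 \<le> n" for n :: int
  proof -
    have "1 * (\<sigma> + a) \<le> of_int n * (\<sigma> + a)" using that a \<sigma> by (intro mult_right_mono) auto
    then show ?thesis using half_period by argo
  qed
  have same: "r' = r" if "k' = k"
  proof (rule ccontr)
    assume "r' \<noteq> r"
    then have "1 \<le> r' - r \<or> 1 \<le> r - r'" by linarith
    then show False using large [of "r' - r"] large [of "r - r'"] X that
      by (auto simp: X_def algebra_simps)
  qed
  have zero: "r' = r \<or> r' = r - 1" if "k = 0" "k' = 1"
  proof (rule ccontr)
    assume "\<not> ?thesis"
    then have "1 \<le> r' - r \<or> 1 \<le> r - r' - 1" by linarith
    then show False using large [of "r' - r"] large [of "r - r' - 1"] X that a \<sigma>
      by (auto simp: X_def algebra_simps)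
  qed
  have one: "r' = r \<or> r' = r + 1" if "k = 1" "k' = 0"
  proof (rule ccontr)
    assume "\<not> ?thesis"
    then have "1 \<le> r - r' \<or> 1 \<le> r' - r - 1" by linarith
    then show False using large [of "r - r'"] large [of "r' - r - 1"] X that a \<sigma>
      by (auto simp: X_def algebra_simps)
  qed
  consider "k' = k" | "k' = 1 - k" "r' = r" | "k' = 1 - k" "r' = r + 2 * k - 1"
    using k same zero one by auto
  then show ?thesis
  proof cases
    case 1
    then have "r' = r" "even (q' - q)" using same ev by auto
    then show ?thesis using 1 even_case k by (simp add: atom_eq_iff)
  next
    case 2
    then have "odd (q' - q)" using ev k by auto
    then show ?thesis using 2 odd_case k by (auto simp: atom_eq_iff)
  next
    case 3
    then have "even (q' - q)" using ev k by auto
    then show ?thesis using 3 even_case k by (auto simp: atom_eq_iff)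
  qed
qed

lemma nbr_vectors_eq:
  assumes k: "k \<in> {0, 1}" and ev: "even (q - r - k)"
  shows "nbr_vectors T (P r k q) = {axial_bond r k q, skew_bond 1 r k q, skew_bond (-1) r k q}"
proof (intro equalityI subsetI)
  fix d assume d: "d \<in> nbr_vectors T (P r k q)"
  then obtain r' k' q' where z: "P r k q + d = P r' k' q'" and k': "k' \<in> {0, 1}" and ev': "even (q' - r' - k')"
    unfolding nbr_vectors_def T_eq by blast
  have d_eq: "d = P r' k' q' - P r k q" using z by (simp add: algebra_simps)
  have "norm (P r' k' q' - P r k q) < 1.1" "P r' k' q' \<noteq> P r k q"
    using d d_eq by (auto simp: nbr_vectors_def)
  then show "d \<in> {axial_bond r k q, skew_bond 1 r k q, skew_bond (-1) r k q}"
    using near_atom_cases [OF k k' ev ev'] unfolding d_eq axial_bond_def skew_bond_def by auto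
next
  fix d assume d: "d \<in> {axial_bond r k q, skew_bond 1 r k q, skew_bond (-1) r k q}"
  then have "norm d < 1.1" "d \<noteq> 0"
    using bond_inner_products(1-3) [OF k, of r q] a b by auto
  moreover have "P r k q + d \<in> T"
  proof -
    have "\<exists>r' q'. P r k q + d = P r' (1 - k) q' \<and> even (q' - r' - (1 - k))"
      using d ev by (fastforce simp: axial_bond_def skew_bond_def)
    moreover have "1 - k \<in> {0, 1}" using k by auto
    ultimately show ?thesis unfolding T_eq by blast
  qed
  ultimately show "d \<in> nbr_vectors T (P r k q)" by (simp add: nbr_vectors_def)
qed

text \<open>
  Ordered pairs of bonds are counted, so each of the two angles between bonds of different
  lengths and the angle between the two bonds of length \<open>b\<close> occur twice.
\<close>

lemma energy_per_atom:
  fixes v2 v3 :: "real \<Rightarrow> real"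
  assumes y: "y \<in> T"
  shows "(\<Sum>d\<in>nbr_vectors T y. v2 (norm d)) +
      (\<Sum>d\<in>nbr_vectors T y. \<Sum>e\<in>nbr_vectors T y - {d}. v3 (arccos (cos_angle d e))) =
    v2 a + 2 * v2 b + 4 * v3 (arccos (- \<sigma> / b)) +
    2 * v3 (arccos (1 - 2 * (cos (pi / (2 * real ell)))\<^sup>2 * (1 - (- \<sigma> / b)\<^sup>2)))"
proof -
  obtain r k q where y: "y = P r k q" and k: "k \<in> {0, 1}" and ev: "even (q - r - k)"
    using y unfolding T_eq by blast
  define d0 dp dm where "d0 = axial_bond r k q" and "dp = skew_bond 1 r k q" and "dm = skew_bond (-1) r k q"
  note ip = bond_inner_products [OF k, of r q, folded d0_def dp_def dm_def]
  note ne = bonds_distinct [OF k, of r q, folded d0_def dp_def dm_def]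
  have sym: "cos_angle d e = cos_angle e d" for d e
    by (simp add: cos_angle_def inner_commute mult.commute)
  have angles: "cos_angle d0 dp = - \<sigma> / b" "cos_angle d0 dm = - \<sigma> / b"
    "cos_angle dp dm = 1 - 2 * (cos (pi / (2 * real ell)))\<^sup>2 * (1 - (- \<sigma> / b)\<^sup>2)"
    using a b by (simp_all add: cos_angle_def ip) (simp add: field_simps power2_eq_square)
  have diffs: "{d0, dp, dm} - {d0} = {dp, dm}" "{d0, dp, dm} - {dp} = {d0, dm}"
    "{d0, dp, dm} - {dm} = {d0, dp}"
    using ne by auto
  show ?thesis
    unfolding y nbr_vectors_eq [OF k ev] d0_def [symmetric] dp_def [symmetric] dm_def [symmetric]
    using ne ne [symmetric] by (simp add: diffs ip sym [of _ d0] sym [of dm dp] angles)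
qed

lemma cell_eq:
  "cell T (real m * (2 * (\<sigma> + a))) =
    (\<lambda>(r, k, i). P r k (r + k + 2 * i)) ` ({0..<2 * int m} \<times> {0, 1} \<times> {0..<int ell})"
proof -
  have slab: "0 \<le> of_int r * (\<sigma> + a) + of_int k * \<sigma> \<and>
      of_int r * (\<sigma> + a) + of_int k * \<sigma> < real m * (2 * (\<sigma> + a)) \<longleftrightarrow> r \<in> {0..<2 * int m}"
    if k: "k \<in> {0, 1}" for r k
  proof -
    have h: "0 < \<sigma> + a" and ks: "0 \<le> of_int k * \<sigma>" "of_int k * \<sigma> < \<sigma> + a" using a \<sigma> k by auto
    have mono: "of_int i * (\<sigma> + a) \<le> of_int j * (\<sigma> + a)" if "i \<le> j" for i j :: int
      using that h by (intro mult_right_mono) auto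
    have "real m * (2 * (\<sigma> + a)) = of_int (2 * int m) * (\<sigma> + a)" by simp
    moreover have "0 \<le> of_int r * (\<sigma> + a) + of_int k * \<sigma>" if "0 \<le> r" using mono [OF that] ks by simp
    moreover have "of_int r * (\<sigma> + a) + of_int k * \<sigma> < 0" if "\<not> 0 \<le> r"
      using mono [of r "-1"] that ks by simp
    moreover have "of_int r * (\<sigma> + a) + of_int k * \<sigma> < of_int (2 * int m) * (\<sigma> + a)" if "r < 2 * int m"
      using mono [of r "2 * int m - 1"] that ks by (simp add: algebra_simps)
    moreover have "of_int (2 * int m) * (\<sigma> + a) \<le> of_int r * (\<sigma> + a) + of_int k * \<sigma>" if "\<not> r < 2 * int m"
      using order_trans [OF mono [of "2 * int m" r], of "of_int r * (\<sigma> + a) + of_int k * \<sigma>"] that ks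
      by simp
    ultimately show ?thesis by (metis atLeastLessThan_iff not_less)
  qed
  show ?thesis
  proof (intro equalityI subsetI)
    fix x assume x: "x \<in> cell T (real m * (2 * (\<sigma> + a)))"
    then obtain r k q where x_eq: "x = P r k q" and k: "k \<in> {0, 1}" and ev: "even (q - r - k)"
      unfolding cell_def T_eq by blast
    have r: "r \<in> {0..<2 * int m}" using x slab [OF k, of r] by (simp add: cell_def inner_e1 x_eq)
    define j where "j = (q - r - k) div 2"
    have q: "q = r + k + 2 * j" using ev by (simp add: j_def)
    have "int ell dvd j - j mod int ell" by (rule dvd_minus_mod)
    then have "2 * int ell dvd 2 * (j - j mod int ell)" by (rule mult_dvd_mono [OF dvd_refl])
    also have "2 * (j - j mod int ell) = q - (r + k + 2 * (j mod int ell))"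
      by (simp add: q algebra_simps)
    finally have "x = P r k (r + k + 2 * (j mod int ell))" using k by (simp add: x_eq atom_eq_iff)
    moreover have "j mod int ell \<in> {0..<int ell}" using ell by simp
    ultimately show "x \<in> (\<lambda>(r, k, i). P r k (r + k + 2 * i)) ` ({0..<2 * int m} \<times> {0, 1} \<times> {0..<int ell})"
      using r k by (intro image_eqI [of _ _ "(r, k, j mod int ell)"]) auto
  next
    fix x assume "x \<in> (\<lambda>(r, k, i). P r k (r + k + 2 * i)) ` ({0..<2 * int m} \<times> {0, 1} \<times> {0..<int ell})"
    then obtain p where p: "p \<in> {0..<2 * int m} \<times> {0, 1} \<times> {0..<int ell}"
      and x_p: "x = (\<lambda>(r, k, i). P r k (r + k + 2 * i)) p"
      by blast
    obtain r k i where "p = (r, k, i)" by (cases p)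
    then have x: "x = P r k (r + k + 2 * i)" and r: "r \<in> {0..<2 * int m}" and k: "k \<in> {0, 1}"
      using p x_p by auto
    have "even (r + k + 2 * i - r - k)" by simp
    then have "x \<in> T" unfolding T_eq using x k by blast
    then show "x \<in> cell T (real m * (2 * (\<sigma> + a)))"
      using slab [OF k, of r] r by (simp add: cell_def inner_e1 x)
  qed
qed

lemma card_cell: "card (cell T (real m * (2 * (\<sigma> + a)))) = 4 * m * ell"
proof -
  have "inj_on (\<lambda>(r, k, i). P r k (r + k + 2 * i)) ({0..<2 * int m} \<times> {0, 1} \<times> {0..<int ell})"
  proof (rule inj_onI)
    fix p p' assume p: "p \<in> {0..<2 * int m} \<times> {0, 1} \<times> {0..<int ell}"
      and p': "p' \<in> {0..<2 * int m} \<times> {0, 1} \<times> {0..<int ell}"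
      and eq_p: "(\<lambda>(r, k, i). P r k (r + k + 2 * i)) p = (\<lambda>(r, k, i). P r k (r + k + 2 * i)) p'"
    obtain r k i where p_eq: "p = (r, k, i)" by (cases p)
    obtain r' k' i' where p'_eq: "p' = (r', k', i')" by (cases p')
    have k: "k \<in> {0, 1}" "k' \<in> {0, 1}" and i: "i \<in> {0..<int ell}" "i' \<in> {0..<int ell}"
      and eq: "P r k (r + k + 2 * i) = P r' k' (r' + k' + 2 * i')"
      using p p' eq_p by (simp_all add: p_eq p'_eq)
    have "r = r' \<and> k = k' \<and> 2 * int ell dvd r + k + 2 * i - (r' + k' + 2 * i')"
      using eq atom_eq_iff [OF k] by blast
    then have rk: "r = r'" "k = k'" and dvd: "2 * int ell dvd r + k + 2 * i - (r' + k' + 2 * i')"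
      by blast+
    have "r + k + 2 * i - (r' + k' + 2 * i') = 2 * (i - i')" using rk by simp
    then have "int ell dvd i - i'" using dvd by (simp only: dvd_mult_cancel_left) simp
    moreover have "\<bar>i - i'\<bar> < int ell" using i by auto
    ultimately have "i = i'" using zdvd_not_zless [of "\<bar>i - i'\<bar>" "int ell"] by auto
    then show "p = p'" using rk by (simp add: p_eq p'_eq)
  qed
  then show ?thesis unfolding cell_eq by (simp add: card_image card_cartesian_product nat_mult_distrib)
qed

lemma energy_eq:
  assumes m: "1 \<le> m"
  shows "energy v2 v3 (cell T (real m * (2 * (\<sigma> + a)))) (real m * (2 * (\<sigma> + a))) =
    2 * real m * real ell * (v2 a + 2 * v2 b + 4 * v3 (arccos (- \<sigma> / b)) +
    2 * v3 (arccos (1 - 2 * (cos (pi / (2 * real ell)))\<^sup>2 * (1 - (- \<sigma> / b)\<^sup>2))))"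
proof -
  define L where "L = real m * (2 * (\<sigma> + a))"
  have "1 * (2 * (\<sigma> + a)) \<le> L" unfolding L_def using m a \<sigma> by (intro mult_right_mono) auto
  then have L: "2.2 \<le> L" using half_period by argo
  have per: "x + (L * t) *\<^sub>R e1 \<in> T" if "x \<in> T" and t: "t \<in> {-1, 0, 1}" for x t
  proof -
    obtain r k q where x: "x = P r k q" and k: "k \<in> {0, 1}" and ev: "even (q - r - k)"
      using \<open>x \<in> T\<close> unfolding T_eq by blast
    obtain s :: int where s: "t = of_int s" using t by (auto intro: that [of "-1"] that [of 0] that [of 1])
    have "x + (L * t) *\<^sub>R e1 = P (r + 2 * int m * s) k q"
      by (simp add: vec_eq_iff forall_3 x s L_def axis_def algebra_simps)
    moreover have "even (q - (r + 2 * int m * s) - k)" using ev by simp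
    ultimately show ?thesis using k unfolding T_eq by blast
  qed
  have fin: "finite (cell T L)" unfolding L_def cell_eq by simp
  have "energy v2 v3 (cell T L) L = (\<Sum>y\<in>cell T L. v2 a + 2 * v2 b + 4 * v3 (arccos (- \<sigma> / b)) +
    2 * v3 (arccos (1 - 2 * (cos (pi / (2 * real ell)))\<^sup>2 * (1 - (- \<sigma> / b)\<^sup>2)))) / 2"
    by (rule trans [OF energy_eq_sum_over_atoms [OF _ L fin]], rule per, assumption, assumption)
      (intro arg_cong [where f = "\<lambda>x. x / 2"] sum.cong refl energy_per_atom, simp add: cell_def)
  then show ?thesis
    unfolding sum_constant card_cell [of m, folded L_def] unfolding L_def by (simp del: distrib_left_numeral)
qed

end

section \<open>Convexity of the energy per atom\<close>

text \<open>
  Twice the energy per atom of the zigzag tube with bond lengths \<open>a\<close> (axial) and \<open>b\<close> and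
  period \<open>\<mu>\<close>, where \<open>K = cos\<^sup>2 (\<pi> / (2 ell))\<close>. The arguments of \<open>arccos\<close> are
  the cosines of the two kinds of bond angles. The limit of an infinitely wide tube is
  \<open>K = 1\<close>.
\<close>

definition atom_energy ::
  "(real \<Rightarrow> real) \<Rightarrow> (real \<Rightarrow> real) \<Rightarrow> real \<Rightarrow> real \<Rightarrow> real \<Rightarrow> real \<Rightarrow> real" where
  "atom_energy v2 v3 K \<mu> a b =
     v2 a + 2 * v2 b + 4 * v3 (arccos ((a - \<mu>/2) / b)) +
     2 * v3 (arccos (1 - 2 * K * (1 - ((a - \<mu>/2) / b)\<^sup>2)))"

lemma smooth_on_imp_C2:
  assumes "smooth_on S f"
  obtains f1 f2 where
    "\<And>x. x \<in> interior S \<Longrightarrow> (f has_real_derivative f1 x) (at x)"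
    "\<And>x. x \<in> interior S \<Longrightarrow> (f1 has_real_derivative f2 x) (at x)"
    "\<And>x. x \<in> interior S \<Longrightarrow> isCont f2 x"
    "\<And>x. x \<in> interior S \<Longrightarrow> deriv (deriv f) x = f2 x"
proof -
  obtain D where D0: "\<And>x. x \<in> S \<Longrightarrow> D 0 x = f x"
    and D: "\<And>n x. x \<in> S \<Longrightarrow> (D n has_real_derivative D (Suc n) x) (at x within S)"
    using assms unfolding smooth_on_def by blast
  have Dat: "(D n has_real_derivative D (Suc n) x) (at x)" if "x \<in> interior S" for n x
    using D [of x n] that interior_subset [of S] at_within_interior [OF that] by auto
  have f1: "(f has_real_derivative D 1 x) (at x)" if "x \<in> interior S" for x
    using has_field_derivative_transform_within_open [OF Dat [OF that, of 0] open_interior that, of f]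
      D0 interior_subset by (auto simp: subset_iff)
  have "deriv (deriv f) x = D 2 x" if "x \<in> interior S" for x
  proof -
    have "\<forall>\<^sub>F y in nhds x. deriv f y = D 1 y"
      using eventually_nhds_in_open [OF open_interior that]
      by eventually_elim (use f1 DERIV_imp_deriv in blast)
    then have "deriv (deriv f) x = deriv (D 1) x" by (rule deriv_cong_ev) simp
    also have "\<dots> = D 2 x" using Dat [OF that, of 1] by (simp add: DERIV_imp_deriv numeral_2_eq_2)
    finally show ?thesis .
  qed
  moreover have "(D 1 has_real_derivative D 2 x) (at x)" if "x \<in> interior S" for x
    using Dat [OF that, of 1] by (simp add: numeral_2_eq_2)
  ultimately show thesis
    using that [of "D 1" "D 2"] f1 Dat DERIV_isCont by blast
qed

lemma arccos_minus_half: "arccos (-1/2) = 2 * pi / 3"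
  using arccos_cos [of "2 * pi / 3"] cos_120 pi_gt_zero by simp

text \<open>
  As a function of the cosine \<open>x\<close> of the angle, \<open>v3\<close> is twice differentiable on
  \<open>(-1,1)\<close> with a nondegenerate zero minimum at \<open>x = -1/2\<close>. This avoids differentiating
  the bond angles with respect to the bond lengths.
\<close>

lemma three_body_cos_C2:
  assumes "three_body_potential v3"
  obtains V1 V2 where
    "\<And>x. \<bar>x\<bar> < 1 \<Longrightarrow> ((\<lambda>x. v3 (arccos x)) has_real_derivative V1 x) (at x)"
    "\<And>x. \<bar>x\<bar> < 1 \<Longrightarrow> (V1 has_real_derivative V2 x) (at x)"
    "isCont V2 (-1/2)" "v3 (arccos (-1/2)) = 0" "V1 (-1/2) = 0" "V2 (-1/2) > 0"
proof -
  have smooth: "smooth_on {0..2*pi} v3" and nonneg: "\<And>\<alpha>. \<alpha> \<in> {0..2*pi} \<Longrightarrow> 0 \<le> v3 \<alpha>"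
    and zero: "\<And>\<alpha>. \<alpha> \<in> {0..2*pi} \<Longrightarrow> v3 \<alpha> = 0 \<longleftrightarrow> \<alpha> = 2*pi/3 \<or> \<alpha> = 4*pi/3"
    and pos: "deriv (deriv v3) (2*pi/3) > 0"
    using assms unfolding three_body_potential_def by blast+
  obtain g h where g: "\<And>x. x \<in> {0<..<2*pi} \<Longrightarrow> (v3 has_real_derivative g x) (at x)"
    and h: "\<And>x. x \<in> {0<..<2*pi} \<Longrightarrow> (g has_real_derivative h x) (at x)"
    and conth: "\<And>x. x \<in> {0<..<2*pi} \<Longrightarrow> isCont h x"
    and d2: "\<And>x. x \<in> {0<..<2*pi} \<Longrightarrow> deriv (deriv v3) x = h x"
    using smooth_on_imp_C2 [OF smooth, unfolded interior_atLeastAtMost_real] by blast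
  have mid: "2*pi/3 \<in> {0<..<2*pi}" using pi_gt_zero by simp
  have v0: "v3 (2*pi/3) = 0" using zero mid by simp
  have g0: "g (2*pi/3) = 0"
  proof (rule DERIV_local_min [OF g [OF mid]])
    show "\<forall>y. \<bar>2*pi/3 - y\<bar> < 2*pi/3 \<longrightarrow> v3 (2*pi/3) \<le> v3 y"
    proof (intro allI impI)
      fix y :: real assume "\<bar>2*pi/3 - y\<bar> < 2*pi/3"
      then have "y \<in> {0..2*pi}" unfolding abs_less_iff atLeastAtMost_iff by linarith
      then show "v3 (2*pi/3) \<le> v3 y" using nonneg v0 by simp
    qed
  qed (use pi_gt_zero in simp)
  define V1 where "V1 x = g (arccos x) * inverse (- sqrt (1 - x\<^sup>2))" for x
  define V2 where "V2 x = h (arccos x) * inverse (- sqrt (1 - x\<^sup>2)) * inverse (- sqrt (1 - x\<^sup>2))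
    + g (arccos x) * - (inverse (- sqrt (1 - x\<^sup>2)) * - (- x / sqrt (1 - x\<^sup>2)) * inverse (- sqrt (1 - x\<^sup>2)))" for x
  have ang: "arccos x \<in> {0<..<2*pi}" if "\<bar>x\<bar> < 1" for x
    using arccos_lt_bounded [of x] that pi_gt_zero by (auto simp: abs_less_iff)
  have root: "sqrt (1 - x\<^sup>2) > 0" if "\<bar>x\<bar> < 1" for x :: real
    using that by (simp add: abs_square_less_1)
  have a1: "((\<lambda>x. v3 (arccos x)) has_real_derivative V1 x) (at x)" if "\<bar>x\<bar> < 1" for x
    unfolding V1_def
    by (rule DERIV_chain2 [OF g DERIV_arccos]) (use ang that in \<open>auto simp: abs_less_iff\<close>)
  have a2: "(V1 has_real_derivative V2 x) (at x)" if "\<bar>x\<bar> < 1" for x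
  proof -
    have e1: "((\<lambda>x. g (arccos x)) has_real_derivative h (arccos x) * inverse (- sqrt (1 - x\<^sup>2))) (at x)"
      by (rule DERIV_chain2 [OF h DERIV_arccos]) (use ang that in \<open>auto simp: abs_less_iff\<close>)
    have pos1: "0 < 1 - x\<^sup>2" using root [OF that] by simp
    have ds: "((\<lambda>x. sqrt (1 - x\<^sup>2)) has_real_derivative - x / sqrt (1 - x\<^sup>2)) (at x)"
      using pos1 by (auto intro!: derivative_eq_intros simp: divide_simps)
    note e2 = DERIV_inverse' [OF DERIV_minus [OF ds]]
    show ?thesis
      unfolding V1_def [abs_def] V2_def
      by (rule DERIV_cong [OF DERIV_mult [OF e1 e2]]) (use root [OF that] in simp, simp only: ac_simps)
  qed
  have half: "\<bar>-1/2 :: real\<bar> < 1" by simp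
  have ca: "isCont arccos (-1/2)" using DERIV_arccos [of "-1/2"] by (auto intro: DERIV_isCont)
  have ch: "isCont (\<lambda>x. h (arccos x)) (-1/2)"
    by (rule isCont_o2 [OF ca conth]) (use ang half in blast)
  have cg: "isCont (\<lambda>x. g (arccos x)) (-1/2)"
    by (rule isCont_o2 [OF ca DERIV_isCont [OF h]]) (use ang half in blast)
  have "isCont V2 (-1/2)"
    unfolding V2_def [abs_def] using root [OF half]
    by (intro continuous_intros ch cg) (auto simp: power2_eq_square)
  moreover have "V2 (-1/2) > 0"
    using pos d2 [OF mid] g0 root [OF half] by (simp add: V2_def arccos_minus_half)
  moreover have "V1 (-1/2) = 0" using g0 by (simp add: V1_def arccos_minus_half)
  ultimately show thesis using that a1 a2 v0 arccos_minus_half by metis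
qed

text \<open>
  Near bond lengths \<open>1\<close>, period \<open>3\<close> and \<open>K = 1\<close> both cosines are near \<open>-1/2\<close>.
\<close>

lemma cos_angle_bounds:
  fixes a b \<mu> K r :: real
  assumes r: "r \<le> 1/60" and a: "\<bar>a - 1\<bar> < r" and b: "\<bar>b - 1\<bar> < r"
    and \<mu>: "\<bar>\<mu> - 3\<bar> < r" and K: "1 - r < K" "K \<le> 1"
  defines "u \<equiv> (a - \<mu>/2) / b"
  shows "\<bar>u + 1/2\<bar> < 3 * r" "\<bar>1 - 2 * K * (1 - u\<^sup>2) + 1/2\<bar> < 14 * r"
proof -
  have b0: "9/10 \<le> b" using b r by linarith
  have "\<bar>a - \<mu>/2 + b/2\<bar> < 2 * r" using a b \<mu> by linarith
  also have "2 * r < 3 * r * b" 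
  proof -
    have "3 * r * (9/10) \<le> 3 * r * b" using b0 a by (intro mult_left_mono) auto
    then show ?thesis using a by linarith
  qed
  finally have "\<bar>(a - \<mu>/2 + b/2) / b\<bar> < 3 * r" using b0 by (simp add: abs_divide field_simps)
  moreover have "u + 1/2 = (a - \<mu>/2 + b/2) / b" using b0 by (simp add: u_def field_simps)
  ultimately show u: "\<bar>u + 1/2\<bar> < 3 * r" by simp
  have "\<bar>u - 1/2\<bar> \<le> 2" "\<bar>u\<bar> \<le> 1" using u r by linarith+
  then have u2: "0 \<le> u\<^sup>2" "u\<^sup>2 \<le> 1" by (auto simp: abs_square_le_1)
  have "\<bar>2 * ((u + 1/2) * (u - 1/2))\<bar> \<le> 2 * (3 * r * 2)"
    unfolding abs_mult using \<open>\<bar>u - 1/2\<bar> \<le> 2\<close> u by (intro mult_mono) auto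
  moreover have "\<bar>2 * ((1 - K) * (1 - u\<^sup>2))\<bar> \<le> 2 * ((1 - K) * 1)"
    unfolding abs_mult using u2 K by (intro mult_mono) auto
  moreover have "1 - 2 * K * (1 - u\<^sup>2) + 1/2 = 2 * ((1 - K) * (1 - u\<^sup>2)) + 2 * ((u + 1/2) * (u - 1/2))"
    by (simp add: field_simps power2_eq_square)
  then have "\<bar>1 - 2 * K * (1 - u\<^sup>2) + 1/2\<bar> \<le> \<bar>2 * ((1 - K) * (1 - u\<^sup>2))\<bar> + \<bar>2 * ((u + 1/2) * (u - 1/2))\<bar>"
    by (simp only: abs_triangle_ineq)
  ultimately have "\<bar>1 - 2 * K * (1 - u\<^sup>2) + 1/2\<bar> \<le> 2 * (1 - K) + 12 * r"
    by simp
  also have "\<dots> < 14 * r" using K by (simp add: algebra_simps)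
  finally show "\<bar>1 - 2 * K * (1 - u\<^sup>2) + 1/2\<bar> < 14 * r" .
qed

lemma midpoint_less_of_second_derivative_pos:
  fixes \<phi> \<phi>' \<phi>'' :: "real \<Rightarrow> real"
  assumes d1: "\<And>t. t \<in> {0..1} \<Longrightarrow> (\<phi> has_real_derivative \<phi>' t) (at t)"
    and d2: "\<And>t. t \<in> {0..1} \<Longrightarrow> (\<phi>' has_real_derivative \<phi>'' t) (at t)"
    and pos: "\<And>t. t \<in> {0..1} \<Longrightarrow> 0 < \<phi>'' t"
  shows "\<phi> (1/2) < max (\<phi> 0) (\<phi> 1)"
proof (rule ccontr)
  assume "\<not> \<phi> (1/2) < max (\<phi> 0) (\<phi> 1)"
  then have le: "\<phi> 0 \<le> \<phi> (1/2)" "\<phi> 1 \<le> \<phi> (1/2)" by auto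
  obtain x where x: "0 < x" "x < 1/2" "\<phi> (1/2) - \<phi> 0 = (1/2 - 0) * \<phi>' x"
    using MVT2 [of 0 "1/2" \<phi> \<phi>'] d1 by auto
  obtain y where y: "1/2 < y" "y < 1" "\<phi> 1 - \<phi> (1/2) = (1 - 1/2) * \<phi>' y"
    using MVT2 [of "1/2" 1 \<phi> \<phi>'] d1 by auto
  have "\<phi>' x < \<phi>' y"
  proof (rule DERIV_pos_imp_increasing [where f = \<phi>' and a = x and b = y])
    show "x < y" using x y by simp
    fix z assume "x \<le> z" "z \<le> y"
    then have "z \<in> {0..1}" using x y by simp
    then show "\<exists>D. (\<phi>' has_real_derivative D) (at z) \<and> D > 0" using d2 pos by blast
  qed
  then show False using le x y by auto
qed

text \<open>
  Strict convexity near the reference configuration: along a segment the second derivative of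
  the two-body part is at least \<open>\<kappa>\<close> times the squared length, while the three-body part
  contributes nonnegative terms with \<open>V2\<close> and terms with the small factor \<open>V1\<close>.
\<close>

lemma atom_energy_midpoint_less:
  fixes a b a' b' \<mu> K r \<kappa> :: real
  assumes r: "r \<le> 1/60" and \<mu>: "\<bar>\<mu> - 3\<bar> < r" and K: "1 - r < K" "K \<le> 1" and \<kappa>: "0 < \<kappa>"
    and v2: "\<And>x. \<bar>x - 1\<bar> < r \<Longrightarrow> (v2 has_real_derivative v2' x) (at x)"
            "\<And>x. \<bar>x - 1\<bar> < r \<Longrightarrow> (v2' has_real_derivative v2'' x) (at x)"
            "\<And>x. \<bar>x - 1\<bar> < r \<Longrightarrow> \<kappa> \<le> v2'' x"
    and V: "\<And>x. \<bar>x + 1/2\<bar> < 14 * r \<Longrightarrow> ((\<lambda>x. v3 (arccos x)) has_real_derivative V1 x) (at x)"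
            "\<And>x. \<bar>x + 1/2\<bar> < 14 * r \<Longrightarrow> (V1 has_real_derivative V2 x) (at x)"
            "\<And>x. \<bar>x + 1/2\<bar> < 14 * r \<Longrightarrow> \<bar>V1 x\<bar> \<le> \<kappa> / 200"
            "\<And>x. \<bar>x + 1/2\<bar> < 14 * r \<Longrightarrow> 0 \<le> V2 x"
    and ab: "\<bar>a - 1\<bar> < r" "\<bar>b - 1\<bar> < r" and ab': "\<bar>a' - 1\<bar> < r" "\<bar>b' - 1\<bar> < r"
    and neq: "(a, b) \<noteq> (a', b')"
  shows "atom_energy v2 v3 K \<mu> ((a + a')/2) ((b + b')/2) <
    max (atom_energy v2 v3 K \<mu> a b) (atom_energy v2 v3 K \<mu> a' b')"
proof -
  define p q where "p = a' - a" and "q = b' - b"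
  define N where "N = p\<^sup>2 + q\<^sup>2"
  define n where "n = p * b - (a - \<mu>/2) * q"
  define A where "A t = a + t * p" for t
  define B where "B t = b + t * q" for t
  define u where "u t = (A t - \<mu>/2) / B t" for t
  define w where "w t = 1 - 2 * K * (1 - (u t)\<^sup>2)" for t
  \<comment> \<open>First and second derivatives: the numerator \<open>n\<close> of \<open>u1\<close> does not depend on
    \<open>t\<close>, because \<open>u\<close> is a quotient of affine functions.\<close>
  define u1 where "u1 t = n / (B t)\<^sup>2" for t
  define u2 where "u2 t = - 2 * q * n / (B t) ^ 3" for t
  define w1 where "w1 t = 4 * K * (u t * u1 t)" for t
  define w2 where "w2 t = 4 * K * ((u1 t)\<^sup>2 + u t * u2 t)" for t
  define \<phi> where "\<phi> t = v2 (A t) + 2 * v2 (B t) + 4 * v3 (arccos (u t)) + 2 * v3 (arccos (w t))" for t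
  define \<phi>' where "\<phi>' t = v2' (A t) * p + 2 * (v2' (B t) * q) + 4 * (V1 (u t) * u1 t) + 2 * (V1 (w t) * w1 t)" for t
  define \<phi>'' where "\<phi>'' t = v2'' (A t) * p\<^sup>2 + 2 * (v2'' (B t) * q\<^sup>2)
    + 4 * (V2 (u t) * (u1 t)\<^sup>2 + V1 (u t) * u2 t) + 2 * (V2 (w t) * (w1 t)\<^sup>2 + V1 (w t) * w2 t)" for t
  have seg: "\<bar>A t - 1\<bar> < r" "\<bar>B t - 1\<bar> < r" if "t \<in> {0..1}" for t
  proof -
    have conv: "\<bar>x + t * (x' - x) - 1\<bar> < r" if "\<bar>x - 1\<bar> < r" "\<bar>x' - 1\<bar> < r" for x x' :: real
    proof -
      have "(1 - t) *\<^sub>R x + t *\<^sub>R x' \<in> ball 1 r"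
        using that \<open>t \<in> {0..1}\<close>
        by (intro convexD [OF convex_ball]) (auto simp: dist_real_def abs_minus_commute)
      then show ?thesis by (simp add: dist_real_def abs_minus_commute algebra_simps)
    qed
    show "\<bar>A t - 1\<bar> < r" "\<bar>B t - 1\<bar> < r"
      unfolding A_def B_def p_def q_def by (intro conv ab ab')+
  qed
  have Bpos: "0 < B t" if "t \<in> {0..1}" for t using seg [OF that] r by linarith
  have uw: "\<bar>u t + 1/2\<bar> < 3 * r" "\<bar>w t + 1/2\<bar> < 14 * r" if "t \<in> {0..1}" for t
    using cos_angle_bounds [OF r seg [OF that] \<mu> K] by (auto simp: u_def w_def)
  have uw': "\<bar>u t + 1/2\<bar> < 14 * r" if "t \<in> {0..1}" for t using uw [OF that] by linarith
  have dA: "(A has_real_derivative p) (at t)" and dB: "(B has_real_derivative q) (at t)" for t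
    unfolding A_def [abs_def] B_def [abs_def] by (auto intro!: derivative_eq_intros)
  have du: "(u has_real_derivative u1 t) (at t)" if "t \<in> {0..1}" for t
    unfolding u_def [abs_def] u1_def
    by (rule DERIV_cong [OF DERIV_divide [OF DERIV_diff [OF dA DERIV_const] dB]])
      (use Bpos [OF that] in \<open>auto simp: n_def A_def B_def power2_eq_square algebra_simps\<close>)
  have du1: "(u1 has_real_derivative u2 t) (at t)" if "t \<in> {0..1}" for t
    unfolding u1_def [abs_def] u2_def
    by (rule DERIV_cong [OF DERIV_divide [OF DERIV_const DERIV_power [OF dB, of 2]]])
      (use Bpos [OF that] in \<open>auto simp: power2_eq_square power3_eq_cube divide_simps\<close>)
  have dw: "(w has_real_derivative w1 t) (at t)" if "t \<in> {0..1}" for t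
    unfolding w_def [abs_def] w1_def
    by (auto intro!: derivative_eq_intros du that)
  have dw1: "(w1 has_real_derivative w2 t) (at t)" if "t \<in> {0..1}" for t
    unfolding w1_def [abs_def] w2_def
    by (auto intro!: derivative_eq_intros du du1 that simp: power2_eq_square)
  have "\<phi> (1/2) < max (\<phi> 0) (\<phi> 1)"
  proof (rule midpoint_less_of_second_derivative_pos)
    fix t :: real assume t: "t \<in> {0..1}"
    have dvA: "((\<lambda>t. v2 (A t)) has_real_derivative v2' (A t) * p) (at t)"
      and dvA': "((\<lambda>t. v2' (A t)) has_real_derivative v2'' (A t) * p) (at t)"
      by (rule DERIV_chain2 [OF v2(1) dA] DERIV_chain2 [OF v2(2) dA], rule seg(1) [OF t])+
    have dvB: "((\<lambda>t. v2 (B t)) has_real_derivative v2' (B t) * q) (at t)"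
      and dvB': "((\<lambda>t. v2' (B t)) has_real_derivative v2'' (B t) * q) (at t)"
      by (rule DERIV_chain2 [OF v2(1) dB] DERIV_chain2 [OF v2(2) dB], rule seg(2) [OF t])+
    have dVu: "((\<lambda>t. v3 (arccos (u t))) has_real_derivative V1 (u t) * u1 t) (at t)"
      and dVu': "((\<lambda>t. V1 (u t)) has_real_derivative V2 (u t) * u1 t) (at t)"
      by (rule DERIV_chain2 [OF V(1) du] DERIV_chain2 [OF V(2) du], rule uw' [OF t], rule t)+
    have dVw: "((\<lambda>t. v3 (arccos (w t))) has_real_derivative V1 (w t) * w1 t) (at t)"
      and dVw': "((\<lambda>t. V1 (w t)) has_real_derivative V2 (w t) * w1 t) (at t)"
      by (rule DERIV_chain2 [OF V(1) dw] DERIV_chain2 [OF V(2) dw], rule uw(2) [OF t], rule t)+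
    show "(\<phi> has_real_derivative \<phi>' t) (at t)"
      unfolding \<phi>_def [abs_def] \<phi>'_def
      by (intro DERIV_add DERIV_cmult dvA dvB dVu dVw)
    have "(\<phi>' has_real_derivative
       (v2'' (A t) * p) * p + 2 * ((v2'' (B t) * q) * q) +
       4 * (V2 (u t) * u1 t * u1 t + u2 t * V1 (u t)) + 2 * (V2 (w t) * w1 t * w1 t + w2 t * V1 (w t))) (at t)"
      unfolding \<phi>'_def [abs_def]
      by (intro DERIV_add DERIV_cmult DERIV_cmult_right DERIV_mult dvA' dvB' dVu' dVw' du1 dw1 t)
    then show "(\<phi>' has_real_derivative \<phi>'' t) (at t)"
      by (rule DERIV_cong) (simp add: \<phi>''_def power2_eq_square algebra_simps)
    have "p \<noteq> 0 \<or> q \<noteq> 0" using neq by (auto simp: p_def q_def)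
    then have N0: "0 < N" by (auto simp: N_def sum_power2_gt_zero_iff)
    have Bt: "59/60 \<le> B t" using seg [OF t] r by linarith
    \<comment> \<open>The Cauchy-Schwarz inequality for \<open>n\<close>, as Lagrange's identity.\<close>
    have n2: "n\<^sup>2 \<le> 2 * N"
    proof -
      define s where "s = a - \<mu>/2"
      have s: "\<bar>s\<bar> \<le> 3/5" using ab \<mu> r unfolding s_def by linarith
      have "s\<^sup>2 \<le> (3/5)\<^sup>2" using s by (rule power2_le_iff_abs_le [THEN iffD2, rotated]) simp
      moreover have "b\<^sup>2 \<le> (11/10)\<^sup>2" using ab r by (intro power_mono) linarith+
      ultimately have "b\<^sup>2 + s\<^sup>2 \<le> 2" by (simp add: power2_eq_square)
      then have "(b\<^sup>2 + s\<^sup>2) * N \<le> 2 * N" using N0 by (intro mult_right_mono) auto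
      moreover have "(b\<^sup>2 + s\<^sup>2) * N = n\<^sup>2 + (b * q + s * p)\<^sup>2"
        by (simp add: N_def n_def s_def [symmetric] power2_eq_square algebra_simps)
      ultimately show ?thesis using zero_le_power2 [of "b * q + s * p"] by linarith
    qed
    have pw: "1/2 \<le> B t ^ 4" "1/2 \<le> B t ^ 6"
      using power_mono [OF Bt, of 4] power_mono [OF Bt, of 6] by (simp_all add: power_divide)
    have u1sq: "(u1 t)\<^sup>2 \<le> 4 * N"
    proof -
      have "(u1 t)\<^sup>2 = n\<^sup>2 / B t ^ 4" by (simp add: u1_def power_divide flip: power_mult)
      also have "\<dots> \<le> (2 * N) / (1/2)" using n2 pw N0 by (intro frac_le) auto
      finally show ?thesis by simp
    qed
    have u2abs: "\<bar>u2 t\<bar> \<le> 4 * N"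
    proof -
      have "(u2 t)\<^sup>2 = (4 * (q\<^sup>2 * n\<^sup>2)) / B t ^ 6"
        by (simp add: u2_def power_divide power_mult_distrib flip: power_mult)
      also have "\<dots> \<le> (4 * (N * (2 * N))) / (1/2)"
        using n2 pw N0 by (intro frac_le mult_left_mono mult_mono) (auto simp: N_def)
      also have "\<dots> = (4 * N)\<^sup>2" by (simp add: power2_eq_square)
      finally show ?thesis using N0 by (metis abs_le_square_iff abs_of_pos mult_pos_pos zero_less_numeral)
    qed
    have w2abs: "\<bar>w2 t\<bar> \<le> 32 * N"
    proof -
      have "\<bar>u t\<bar> \<le> 1" using uw [OF t] r by linarith
      then have "\<bar>u t * u2 t\<bar> \<le> 1 * (4 * N)" unfolding abs_mult using u2abs by (intro mult_mono) auto
      then have "\<bar>(u1 t)\<^sup>2 + u t * u2 t\<bar> \<le> 8 * N" using u1sq zero_le_power2 [of "u1 t"] by linarith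
      moreover have "\<bar>4 * K\<bar> \<le> 4" using K r by linarith
      ultimately have "\<bar>4 * K\<bar> * \<bar>(u1 t)\<^sup>2 + u t * u2 t\<bar> \<le> 4 * (8 * N)" by (intro mult_mono) auto
      then show ?thesis unfolding w2_def abs_mult by simp
    qed
    have "\<kappa> * p\<^sup>2 \<le> v2'' (A t) * p\<^sup>2" "\<kappa> * q\<^sup>2 \<le> v2'' (B t) * q\<^sup>2"
      using v2(3) seg [OF t] by (auto intro: mult_right_mono)
    moreover have "0 \<le> \<kappa> * q\<^sup>2" using \<kappa> by simp
    ultimately have lower: "\<kappa> * N \<le> v2'' (A t) * p\<^sup>2 + 2 * (v2'' (B t) * q\<^sup>2)"
      unfolding N_def distrib_left by linarith
    have "\<bar>V1 (u t) * u2 t\<bar> \<le> \<kappa>/200 * (4 * N)"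
      unfolding abs_mult using V(3) [OF uw' [OF t]] u2abs \<kappa> by (intro mult_mono) auto
    then have "- (\<kappa> * N) / 50 \<le> V1 (u t) * u2 t" by linarith
    moreover have "\<bar>V1 (w t) * w2 t\<bar> \<le> \<kappa>/200 * (32 * N)"
      unfolding abs_mult using V(3) [OF uw(2) [OF t]] w2abs \<kappa> by (intro mult_mono) auto
    then have "- (8 * (\<kappa> * N)) / 50 \<le> V1 (w t) * w2 t" by linarith
    moreover have "0 \<le> V2 (u t) * (u1 t)\<^sup>2" "0 \<le> V2 (w t) * (w1 t)\<^sup>2"
      using V(4) [OF uw' [OF t]] V(4) [OF uw(2) [OF t]] by auto
    moreover have "0 < \<kappa> * N" using \<kappa> N0 by auto
    moreover note lower
    ultimately show "0 < \<phi>'' t" unfolding \<phi>''_def distrib_left by linarith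
  qed
  moreover have "A 0 = a" "B 0 = b" "A 1 = a'" "B 1 = b'"
    "A (1/2) = (a + a')/2" "B (1/2) = (b + b')/2"
    by (simp_all add: A_def B_def p_def q_def field_simps)
  then have "\<phi> 0 = atom_energy v2 v3 K \<mu> a b" "\<phi> 1 = atom_energy v2 v3 K \<mu> a' b'"
    "\<phi> (1/2) = atom_energy v2 v3 K \<mu> ((a + a')/2) ((b + b')/2)"
    by (simp_all only: \<phi>_def atom_energy_def u_def w_def)
  ultimately show ?thesis by simp
qed

section \<open>The unique minimizer of the energy per atom\<close>

lemma isCont_eventually_near:
  fixes f :: "real \<Rightarrow> real"
  assumes "isCont f x" "open U" "f x \<in> U"
  obtains d where "0 < d" "\<And>y. \<bar>y - x\<bar> < d \<Longrightarrow> f y \<in> U"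
proof -
  have "\<forall>\<^sub>F y in nhds x. f y \<in> U"
    using assms unfolding isCont_def tendsto_at_iff_tendsto_nhds by (rule topological_tendstoD)
  then show thesis
    using that by (auto simp: eventually_nhds_metric dist_real_def)
qed

lemma two_body_gap:
  assumes v2: "two_body_potential v2" and cont: "continuous_on {0<..} v2" and \<rho>: "0 < \<rho>"
  obtains g where "0 < g" "\<And>x. x \<in> {0.9..1.1} \<Longrightarrow> \<rho> \<le> \<bar>x - 1\<bar> \<Longrightarrow> - 1 + g \<le> v2 x"
proof (cases "\<exists>x\<in>{0.9..1.1}. \<rho> \<le> \<bar>x - 1\<bar>")
  case True
  define S where "S = {0.9..1.1} \<inter> {x :: real. \<rho> \<le> \<bar>x - 1\<bar>}"
  have "compact S"
    unfolding S_def by (intro compact_Int_closed compact_Icc closed_Collect_le continuous_intros)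
  moreover have "S \<noteq> {}" using True by (auto simp: S_def)
  moreover have "continuous_on S v2"
    by (rule continuous_on_subset [OF cont]) (auto simp: S_def)
  ultimately obtain x0 where x0: "x0 \<in> S" "\<And>x. x \<in> S \<Longrightarrow> v2 x0 \<le> v2 x"
    using continuous_attains_inf by metis
  have "x0 > 0" "x0 \<noteq> 1" using x0(1) \<rho> by (auto simp: S_def)
  then have "v2 x0 > -1" using v2 by (auto simp: two_body_potential_def)
  then show thesis using that [of "v2 x0 + 1"] x0(2) by (force simp: S_def)
next
  case False
  then show thesis using that [of 1] by force
qed

text \<open>
  The cosines of all feasible configurations lie in the domain of \<open>arccos\<close>, so that the
  three-body energy is nonnegative there.
\<close>

lemma feasible_cosines:
  fixes a b \<mu> K :: real
  assumes "a \<in> {0.9<..<1.1}" "b \<in> {0.9<..<1.1}" "\<mu> \<in> {2.6<..<3.1}" "0 \<le> K" "K \<le> 1"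
  shows "\<bar>(a - \<mu>/2) / b\<bar> < 1" "\<bar>1 - 2 * K * (1 - ((a - \<mu>/2) / b)\<^sup>2)\<bar> \<le> 1"
proof -
  show u: "\<bar>(a - \<mu>/2) / b\<bar> < 1" using assms by (auto simp: abs_divide abs_less_iff)
  define s where "s = 1 - ((a - \<mu>/2) / b)\<^sup>2"
  have "((a - \<mu>/2) / b)\<^sup>2 \<le> 1" using u abs_square_le_1 less_imp_le by blast
  then have s: "0 \<le> s" "s \<le> 1" by (simp_all add: s_def)
  then have "0 \<le> K * s" "K * s \<le> 1" using assms by (auto intro: mult_le_one)
  then show "\<bar>1 - 2 * K * (1 - ((a - \<mu>/2) / b)\<^sup>2)\<bar> \<le> 1"
    unfolding s_def [symmetric] by (auto simp: abs_le_iff)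
qed

text \<open>
  A minimizer over the open square exists, because the energy at bond lengths \<open>(1,1)\<close> is
  below every value outside a small square around this point; in the small square strict
  convexity excludes a second one. The same \<open>\<delta>\<close> bounds the distance of \<open>\<mu>\<close> to \<open>3\<close> and
  of \<open>K\<close> to \<open>1\<close>.
\<close>

lemma atom_energy_unique_minimizer:
  assumes two: "two_body_potential v2" and three: "three_body_potential v3"
  obtains \<delta> where "0 < \<delta>" "\<delta> \<le> 1/60"
    "\<And>\<mu> K. \<lbrakk>\<bar>\<mu> - 3\<bar> < \<delta>; 1 - \<delta> < K; K \<le> 1\<rbrakk> \<Longrightarrow>
       \<exists>!p. is_arg_min (\<lambda>(a, b). atom_energy v2 v3 K \<mu> a b)
              (\<lambda>(a, b). a \<in> {0.9<..<1.1} \<and> b \<in> {0.9<..<1.1}) p"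
proof -
  have int: "interior {0::real<..} = {0<..}" by (rule interior_open) simp
  have smooth: "smooth_on {0<..} v2" using two by (simp add: two_body_potential_def)
  obtain v2' v2'' where "\<And>x. x \<in> {0<..} \<Longrightarrow> (v2 has_real_derivative v2' x) (at x)"
    "\<And>x. x \<in> {0<..} \<Longrightarrow> (v2' has_real_derivative v2'' x) (at x)"
    "\<And>x. x \<in> {0<..} \<Longrightarrow> isCont v2'' x"
    "\<And>x. x \<in> {0<..} \<Longrightarrow> deriv (deriv v2) x = v2'' x"
    using smooth_on_imp_C2 [OF smooth, unfolded int] by blast
  then have v2': "\<And>x. 0 < x \<Longrightarrow> (v2 has_real_derivative v2' x) (at x)"
    and v2'': "\<And>x. 0 < x \<Longrightarrow> (v2' has_real_derivative v2'' x) (at x)"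
    and cont: "\<And>x. 0 < x \<Longrightarrow> isCont v2'' x"
    and dd: "\<And>x. 0 < x \<Longrightarrow> deriv (deriv v2) x = v2'' x"
    by (simp_all only: greaterThan_iff)
  obtain V1 V2 where V1: "\<And>x. \<bar>x\<bar> < 1 \<Longrightarrow> ((\<lambda>x. v3 (arccos x)) has_real_derivative V1 x) (at x)"
    and V2: "\<And>x. \<bar>x\<bar> < 1 \<Longrightarrow> (V1 has_real_derivative V2 x) (at x)"
    and contV: "isCont V2 (-1/2)" and V0: "v3 (arccos (-1/2)) = 0" "V1 (-1/2) = 0" "V2 (-1/2) > 0"
    by (rule three_body_cos_C2 [OF three]) (rule that)
  have v2_ge: "-1 \<le> v2 x" if "0 < x" for x
    using two that by (cases "x = 1") (simp_all add: two_body_potential_def less_imp_le)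
  have V_ge: "0 \<le> v3 (arccos x)" if "\<bar>x\<bar> \<le> 1" for x
  proof -
    have "arccos x \<in> {0..2*pi}"
      using arccos_lbound [of x] arccos_ubound [of x] that pi_ge_zero
      unfolding abs_le_iff atLeastAtMost_iff by linarith
    then show ?thesis using three unfolding three_body_potential_def by blast
  qed
  define \<kappa> where "\<kappa> = v2'' 1 / 2"
  have "0 < v2'' 1" using two dd [of 1] by (simp add: two_body_potential_def)
  then have \<kappa>: "0 < \<kappa>" "\<kappa> < v2'' 1" by (simp_all add: \<kappa>_def)
  obtain r0 where r0: "0 < r0" "\<And>x. \<bar>x - 1\<bar> < r0 \<Longrightarrow> v2'' x \<in> {\<kappa><..}"
    using isCont_eventually_near [OF cont [of 1], of "{\<kappa><..}"] \<kappa> by auto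
  obtain \<eta>1 where \<eta>1: "0 < \<eta>1" "\<And>x. \<bar>x - (-1/2)\<bar> < \<eta>1 \<Longrightarrow> V2 x \<in> {0<..}"
    using isCont_eventually_near [OF contV, of "{0<..}"] V0 by auto
  have contV1: "isCont V1 (-1/2)" and contV0: "isCont (\<lambda>x. v3 (arccos x)) (-1/2)"
    using DERIV_isCont [OF V2, of "-1/2"] DERIV_isCont [OF V1, of "-1/2"] by auto
  obtain \<eta>2 where \<eta>2: "0 < \<eta>2" "\<And>x. \<bar>x - (-1/2)\<bar> < \<eta>2 \<Longrightarrow> V1 x \<in> {- (\<kappa>/200)<..<\<kappa>/200}"
    using isCont_eventually_near [OF contV1, of "{- (\<kappa>/200)<..<\<kappa>/200}"] V0 \<kappa> by auto
  \<comment> \<open>Each cosine deviates from \<open>-1/2\<close> by less than \<open>14\<close> times the largest deviation of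
    the parameters.\<close>
  define r where "r = Min {1/60, r0, \<eta>1/14, \<eta>2/14}"
  have r: "0 < r" "r \<le> 1/60" "r \<le> r0" "14 * r \<le> \<eta>1" "14 * r \<le> \<eta>2"
    using r0 \<eta>1 \<eta>2 by (auto simp: r_def min_def)
  have near: "\<bar>x\<bar> < 1" if "\<bar>x + 1/2\<bar> < 14 * r" for x :: real
    using that r by linarith
  have "continuous_on {0<..} v2"
    by (auto intro!: continuous_at_imp_continuous_on DERIV_isCont [OF v2'])
  then obtain g where g: "0 < g"
    "\<And>x. x \<in> {0.9..1.1} \<Longrightarrow> r/2 \<le> \<bar>x - 1\<bar> \<Longrightarrow> - 1 + g \<le> v2 x"
    using two_body_gap [OF two, of "r/2"] r by auto
  \<comment> \<open>The weights \<open>4\<close> and \<open>2\<close> of the angles add up to \<open>6\<close>.\<close>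
  obtain \<eta>3 where \<eta>3: "0 < \<eta>3" "\<And>x. \<bar>x - (-1/2)\<bar> < \<eta>3 \<Longrightarrow> v3 (arccos x) \<in> {..<g/6}"
    using isCont_eventually_near [OF contV0, of "{..<g/6}"] V0 g by auto
  define \<delta> where "\<delta> = min r (\<eta>3/14)"
  have \<delta>: "0 < \<delta>" "\<delta> \<le> r" "14 * \<delta> \<le> \<eta>3" using r \<eta>3 by (auto simp: \<delta>_def min_def)
  have "\<exists>!p. is_arg_min (\<lambda>(a, b). atom_energy v2 v3 K \<mu> a b)
              (\<lambda>(a, b). a \<in> {0.9<..<1.1} \<and> b \<in> {0.9<..<1.1}) p"
    if \<mu>: "\<bar>\<mu> - 3\<bar> < \<delta>" and K: "1 - \<delta> < K" "K \<le> 1" for \<mu> K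
  proof -
    define F where "F = atom_energy v2 v3 K \<mu>"
    define feas where "feas a b \<longleftrightarrow> a \<in> {0.9<..<1.1} \<and> b \<in> {0.9<..<1.1}" for a b :: real
    have \<mu>r: "\<bar>\<mu> - 3\<bar> < r" and Kr: "1 - r < K" using \<mu> K \<delta> by linarith+
    have base: "F 1 1 < -3 + g"
    proof -
      let ?u = "(1 - \<mu>/2) / 1"
      have "\<bar>?u + 1/2\<bar> < 3 * \<delta>" "\<bar>1 - 2 * K * (1 - ?u\<^sup>2) + 1/2\<bar> < 14 * \<delta>"
        using cos_angle_bounds [of \<delta> 1 1 \<mu> K] \<delta> r \<mu> K by auto
      then have "\<bar>?u - (-1/2)\<bar> < \<eta>3" "\<bar>1 - 2 * K * (1 - ?u\<^sup>2) - (-1/2)\<bar> < \<eta>3"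
        using \<delta> by linarith+
      then have "v3 (arccos ?u) < g/6" "v3 (arccos (1 - 2 * K * (1 - ?u\<^sup>2))) < g/6"
        using \<eta>3(2) by (metis lessThan_iff)+
      moreover have "v2 1 = -1" using two by (simp add: two_body_potential_def)
      ultimately show ?thesis unfolding F_def atom_energy_def by linarith
    qed
    have outside: "-3 + g \<le> F a b" if "feas a b" "\<not> (\<bar>a - 1\<bar> < r/2 \<and> \<bar>b - 1\<bar> < r/2)" for a b
    proof -
      have "\<mu> \<in> {2.6<..<3.1}" "0 \<le> K" using \<mu>r Kr r by (auto simp: abs_less_iff)
      then have "\<bar>(a - \<mu>/2) / b\<bar> \<le> 1" "\<bar>1 - 2 * K * (1 - ((a - \<mu>/2) / b)\<^sup>2)\<bar> \<le> 1"
        using feasible_cosines [of a b \<mu> K] \<open>feas a b\<close> K by (auto simp: feas_def)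
      note V = this [THEN V_ge]
      have v: "-1 \<le> v2 a" "-1 \<le> v2 b" using \<open>feas a b\<close> by (auto simp: feas_def intro: v2_ge)
      have "r/2 \<le> \<bar>a - 1\<bar> \<or> r/2 \<le> \<bar>b - 1\<bar>"
        using that(2) by (simp add: not_less de_Morgan_conj)
      then have "-3 + g \<le> v2 a + 2 * v2 b"
      proof
        assume "r/2 \<le> \<bar>a - 1\<bar>"
        then have "-1 + g \<le> v2 a" using g(2) [of a] \<open>feas a b\<close> by (auto simp: feas_def)
        then show ?thesis using v by linarith
      next
        assume "r/2 \<le> \<bar>b - 1\<bar>"
        then have "-1 + g \<le> v2 b" using g(2) [of b] \<open>feas a b\<close> by (auto simp: feas_def)
        then show ?thesis using v g(1) by linarith
      qed
      then show ?thesis using V unfolding F_def atom_energy_def by linarith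
    qed
    define Q :: "(real \<times> real) set" where "Q = {1 - r/2..1 + r/2} \<times> {1 - r/2..1 + r/2}"
    have inQ: "\<bar>fst p - 1\<bar> < r" "\<bar>snd p - 1\<bar> < r" "0 < fst p" "0 < snd p" if "p \<in> Q" for p
      using that r by (auto simp: Q_def)
    have feasQ: "feas (fst p) (snd p)" if "p \<in> Q" for p
      using inQ [OF that] r(2) unfolding feas_def greaterThanLessThan_iff by linarith
    have contF: "continuous_on Q (\<lambda>p. F (fst p) (snd p))"
    proof -
      let ?u = "\<lambda>p :: real \<times> real. (fst p - \<mu>/2) / snd p"
      have cv: "continuous_on {0<..} v2"
        by (auto intro!: continuous_at_imp_continuous_on DERIV_isCont [OF v2'])
      have cV: "continuous_on {x. \<bar>x\<bar> < 1} (\<lambda>x. v3 (arccos x))"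
        by (auto intro!: continuous_at_imp_continuous_on DERIV_isCont [OF V1])
      have cu: "continuous_on Q ?u"
        by (intro continuous_intros) (use inQ in force)
      have rng: "\<bar>?u p\<bar> < 1" "\<bar>1 - 2 * K * (1 - (?u p)\<^sup>2)\<bar> < 1" if "p \<in> Q" for p
      proof -
        note bd = cos_angle_bounds [OF r(2) inQ(1,2) [OF that] \<mu>r Kr K(2)]
        show "\<bar>?u p\<bar> < 1" using bd(1) r by linarith
        show "\<bar>1 - 2 * K * (1 - (?u p)\<^sup>2)\<bar> < 1" using bd(2) by (rule near)
      qed
      show ?thesis
        unfolding F_def atom_energy_def
        by (intro continuous_on_add continuous_on_mult continuous_on_const
            continuous_on_compose2 [OF cv] continuous_on_compose2 [OF cV] cu)
          (use inQ rng in \<open>auto intro!: continuous_intros cu\<close>)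
    qed
    have "compact Q" unfolding Q_def by (intro compact_Times compact_Icc)
    moreover have one: "(1, 1) \<in> Q" using r by (auto simp: Q_def)
    ultimately obtain p where p: "p \<in> Q" "\<And>q. q \<in> Q \<Longrightarrow> F (fst p) (snd p) \<le> F (fst q) (snd q)"
      using continuous_attains_inf [OF _ _ contF] by blast
    have p_small: "F (fst p) (snd p) \<le> F 1 1" using p(2) [OF one] by simp
    have min_p: "F (fst p) (snd p) \<le> F a b" if "feas a b" for a b
    proof (cases "\<bar>a - 1\<bar> < r/2 \<and> \<bar>b - 1\<bar> < r/2")
      case True
      then have "a \<in> {1 - r/2..1 + r/2}" "b \<in> {1 - r/2..1 + r/2}"
        unfolding atLeastAtMost_iff by linarith+
      then have "(a, b) \<in> Q" by (simp add: Q_def)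
      then show ?thesis using p(2) by fastforce
    next
      case False
      then show ?thesis using outside [OF that] base p_small by linarith
    qed
    have unique: "(a, b) = (a', b')"
      if "feas a b" "feas a' b'" "F a b \<le> F (fst p) (snd p)" "F a' b' \<le> F (fst p) (snd p)" for a b a' b'
    proof (rule ccontr)
      assume neq: "(a, b) \<noteq> (a', b')"
      have box: "\<bar>x - 1\<bar> < r" "\<bar>y - 1\<bar> < r"
        if "feas x y" "F x y \<le> F (fst p) (snd p)" for x y
      proof -
        have "\<bar>x - 1\<bar> < r/2 \<and> \<bar>y - 1\<bar> < r/2"
          using outside [OF that(1)] base p_small that(2) by (rule_tac ccontr) linarith
        then show "\<bar>x - 1\<bar> < r" "\<bar>y - 1\<bar> < r" using r(1) by linarith+
      qed
      note ab = box [OF that(1,3)] and ab' = box [OF that(2,4)]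
      have "F ((a + a')/2) ((b + b')/2) < max (F a b) (F a' b')"
        unfolding F_def
      proof (rule atom_energy_midpoint_less [OF r(2) \<mu>r Kr K(2) \<kappa>(1) _ _ _ _ _ _ _ ab ab' neq])
        fix x :: real assume x: "\<bar>x - 1\<bar> < r"
        then have "0 < x" using r by linarith
        then show "(v2 has_real_derivative v2' x) (at x)" "(v2' has_real_derivative v2'' x) (at x)"
          by (rule v2' v2'')+
        show "\<kappa> \<le> v2'' x" using r0(2) [of x] x r by auto
      next
        fix x :: real assume x: "\<bar>x + 1/2\<bar> < 14 * r"
        show "((\<lambda>x. v3 (arccos x)) has_real_derivative V1 x) (at x)"
          "(V1 has_real_derivative V2 x) (at x)"
          by (rule V1 V2, rule near [OF x])+
        have "\<bar>x - (-1/2)\<bar> < \<eta>1" "\<bar>x - (-1/2)\<bar> < \<eta>2" using x r by linarith+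
        then show "\<bar>V1 x\<bar> \<le> \<kappa>/200" "0 \<le> V2 x"
          using \<eta>1(2) [of x] \<eta>2(2) [of x] by (auto simp: abs_le_iff)
      qed
      moreover have "feas ((a + a')/2) ((b + b')/2)"
        using that(1,2) by (auto simp: feas_def)
      ultimately show False using min_p that(3,4) by fastforce
    qed
    have "is_arg_min (\<lambda>(a, b). F a b) (\<lambda>(a, b). feas a b) p"
      using min_p feasQ [OF p(1)] by (force simp: is_arg_min_linorder split: prod.splits)
    moreover have "q = p" if "is_arg_min (\<lambda>(a, b). F a b) (\<lambda>(a, b). feas a b) q" for q
    proof -
      have "feas (fst q) (snd q)" "F (fst q) (snd q) \<le> F (fst p) (snd p)"
        using that feasQ [OF p(1)] by (auto simp: is_arg_min_linorder split: prod.splits)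
      then show ?thesis
        using unique [of "fst q" "snd q" "fst p" "snd p"] feasQ [OF p(1)] by simp
    qed
    ultimately show ?thesis unfolding F_def feas_def by blast
  qed
  then show thesis using that [of \<delta>] \<delta> r by auto
qed

section \<open>The minimization problem in terms of the energy per atom\<close>

lemma half_angle_bounds:
  assumes "4 \<le> ell"
  shows "0 < pi / (2 * real ell)" "pi / (2 * real ell) \<le> pi / 8"
    "0 < cos (pi / (2 * real ell))" "0.85 \<le> (cos (pi / (2 * real ell)))\<^sup>2" "(cos (pi / (2 * real ell)))\<^sup>2 \<le> 1"
proof -
  define \<phi> where "\<phi> = pi / (2 * real ell)"
  show pos: "0 < pi / (2 * real ell)" using assms by simp
  show le: "pi / (2 * real ell) \<le> pi / 8" by (intro divide_left_mono) (use assms in auto)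
  have \<phi>: "0 < \<phi>" "\<phi> \<le> pi / 8" using pos le by (simp_all add: \<phi>_def)
  show "0 < cos (pi / (2 * real ell))"
    unfolding \<phi>_def [symmetric] using \<phi> pi_gt_zero by (intro cos_gt_zero_pi) linarith+
  have "cos (pi/4) \<le> cos (2 * \<phi>)" using \<phi> pi_gt_zero by (intro cos_monotone_0_pi_le) auto
  moreover have "0.7 \<le> cos (pi/4)"
  proof -
    have "1.4 \<le> sqrt 2" by (rule real_le_rsqrt) (simp add: power2_eq_square)
    then show ?thesis by (simp add: cos_45)
  qed
  ultimately show "0.85 \<le> (cos (pi / (2 * real ell)))\<^sup>2"
    using cos_double_cos [of \<phi>] by (simp add: \<phi>_def)
  show "(cos (pi / (2 * real ell)))\<^sup>2 \<le> 1" by (simp add: abs_square_le_1)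
qed

text \<open>
  The extreme case for the width condition is \<open>a = b = 0.9\<close>, \<open>\<mu> = 3.1\<close> with the smallest
  admissible \<open>ell\<close>.
\<close>

lemma zigzag_geometry_of_bond_lengths:
  fixes a b \<mu> :: real
  assumes ell: "4 \<le> ell" and a: "a \<in> {0.9<..<1.1}" and b: "b \<in> {0.9<..<1.1}" and \<mu>: "\<mu> \<in> {2.6<..<3.1}"
  defines "\<sigma> \<equiv> \<mu>/2 - a"
  defines "\<rho> \<equiv> sqrt (b\<^sup>2 - \<sigma>\<^sup>2) / (2 * sin (pi / (2 * real ell)))"
  shows "zigzag_geometry ell a b \<sigma> \<rho>" and "zigzag_parameters ell \<mu> a b \<sigma> \<rho>"
proof -
  define \<phi> where "\<phi> = pi / (2 * real ell)"
  define h where "h = sqrt (b\<^sup>2 - \<sigma>\<^sup>2)"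
  note \<phi> = half_angle_bounds [OF ell, folded \<phi>_def]
  have \<sigma>: "0.2 < \<sigma>" "\<sigma> < 0.65" using a \<mu> by (auto simp: \<sigma>_def)
  have sq: "\<sigma>\<^sup>2 \<le> 0.65\<^sup>2" "0.2\<^sup>2 \<le> \<sigma>\<^sup>2" "0.9\<^sup>2 \<le> b\<^sup>2" "b\<^sup>2 \<le> 1.1\<^sup>2"
    using \<sigma> b by (intro power_mono; simp)+
  then have hsq: "0.38 < b\<^sup>2 - \<sigma>\<^sup>2" "b\<^sup>2 - \<sigma>\<^sup>2 < 1.3\<^sup>2" by (simp_all add: power2_eq_square)
  then have h: "0 < h" "h\<^sup>2 = b\<^sup>2 - \<sigma>\<^sup>2" by (simp_all add: h_def)
  have h_less: "h < \<mu>/2"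
  proof -
    have "h < 1.3" using hsq unfolding h_def by (intro real_less_lsqrt) auto
    then show ?thesis using \<mu> by auto
  qed
  have s: "0 < sin \<phi>" using \<phi> pi_gt_zero by (intro sin_gt_zero) linarith+
  have \<rho>_eq: "\<rho> = h / (2 * sin \<phi>)" by (simp add: \<rho>_def h_def \<phi>_def)
  then have \<rho>: "0 < \<rho>" using h s by simp
  have "h = 2 * \<rho> * sin \<phi>" using s by (simp add: \<rho>_eq)
  then have rad: "4 * \<rho>\<^sup>2 * (sin \<phi>)\<^sup>2 = h\<^sup>2" by (simp add: power_mult_distrib)
  have bond: "\<sigma>\<^sup>2 + 4 * \<rho>\<^sup>2 * (sin \<phi>)\<^sup>2 = b\<^sup>2" using rad h by simp
  have "sin (pi / real ell) = 2 * sin \<phi> * cos \<phi>"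
    using sin_double [of \<phi>] by (simp add: \<phi>_def)
  then have "4 * \<rho>\<^sup>2 * (sin (pi / real ell))\<^sup>2 = 4 * (4 * \<rho>\<^sup>2 * (sin \<phi>)\<^sup>2) * (cos \<phi>)\<^sup>2"
    by (simp add: power_mult_distrib)
  also have "\<dots> = 4 * (h\<^sup>2 * (cos \<phi>)\<^sup>2)" unfolding rad by simp
  finally have wide_eq: "4 * \<rho>\<^sup>2 * (sin (pi / real ell))\<^sup>2 = 4 * (h\<^sup>2 * (cos \<phi>)\<^sup>2)" .
  have "0.38 * 0.85 \<le> h\<^sup>2 * (cos \<phi>)\<^sup>2" using hsq \<phi>(4) h by (intro mult_mono) auto
  then have wide: "1.1\<^sup>2 \<le> 4 * \<rho>\<^sup>2 * (sin (pi / real ell))\<^sup>2"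
    unfolding wide_eq by (simp add: power2_eq_square)
  show "zigzag_geometry ell a b \<sigma> \<rho>"
    using ell a b \<mu> \<sigma> \<rho> bond wide by unfold_locales (auto simp: \<phi>_def \<sigma>_def)
  have "\<rho> < \<mu> / (4 * sin \<phi>)" using h_less s by (simp add: \<rho>_eq field_simps)
  then show "zigzag_parameters ell \<mu> a b \<sigma> \<rho>"
    unfolding zigzag_parameters_def \<phi>_def [symmetric]
    using a b \<mu> \<sigma> \<rho> bond by (auto simp: \<sigma>_def)
qed

lemma Emin_feasible_iff:
  assumes "4 \<le> ell" "\<mu> \<in> {2.6<..<3.1}"
  shows "Emin_feasible ell \<mu> (a, b) \<longleftrightarrow> a \<in> {0.9<..<1.1} \<and> b \<in> {0.9<..<1.1}"
proof -
  have "zigzag ell a b \<mu> \<in> zigzag_family ell \<mu>" if ab: "a \<in> {0.9<..<1.1}" "b \<in> {0.9<..<1.1}"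
    using zigzag_geometry_of_bond_lengths(2) [OF assms(1) ab assms(2)]
    unfolding zigzag_family_def zigzag_def Let_def
    by (intro CollectI exI [of _ a] exI [of _ b] exI [of _ "\<mu>/2 - a"] exI [of _ id]
        exI [of _ "sqrt (b\<^sup>2 - (\<mu>/2 - a)\<^sup>2) / (2 * sin (pi / (2 * real ell)))"]) simp
  then show ?thesis by (auto simp: Emin_feasible_def)
qed

lemma zigzag_energy_eq:
  assumes m: "1 \<le> m" and ell: "4 \<le> ell"
    and a: "a \<in> {0.9<..<1.1}" and b: "b \<in> {0.9<..<1.1}" and \<mu>: "\<mu> \<in> {2.6<..<3.1}"
  shows "zigzag_energy v2 v3 m ell a b \<mu> =
    2 * real m * real ell * atom_energy v2 v3 ((cos (pi / (2 * real ell)))\<^sup>2) \<mu> a b"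
proof -
  interpret zigzag_geometry ell a b "\<mu>/2 - a"
    "sqrt (b\<^sup>2 - (\<mu>/2 - a)\<^sup>2) / (2 * sin (pi / (2 * real ell)))"
    by (rule zigzag_geometry_of_bond_lengths(1) [OF ell a b \<mu>])
  have "2 * (\<mu>/2 - a + a) = \<mu>" "- (\<mu>/2 - a) / b = (a - \<mu>/2) / b" by simp_all
  with energy_eq [OF m, of v2 v3] show ?thesis
    by (simp only: zigzag_energy_def zigzag_def Let_def atom_energy_def)
qed

lemma is_arg_min_scale:
  fixes f g :: "'a \<Rightarrow> real"
  assumes "0 < c" "\<And>x. P x \<Longrightarrow> f x = c * g x"
  shows "is_arg_min f P = is_arg_min g P"
  using assms by (auto simp: is_arg_min_linorder fun_eq_iff)

lemma Emin_solution_iff: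
  assumes m: "1 \<le> m" and ell: "4 \<le> ell" and \<mu>: "\<mu> \<in> {2.6<..<3.1}"
  shows "Emin_solution v2 v3 m ell \<mu> p \<longleftrightarrow>
    is_arg_min (\<lambda>(a, b). atom_energy v2 v3 ((cos (pi / (2 * real ell)))\<^sup>2) \<mu> a b)
      (\<lambda>(a, b). a \<in> {0.9<..<1.1} \<and> b \<in> {0.9<..<1.1}) p"
proof -
  have feas: "Emin_feasible ell \<mu> = (\<lambda>(a, b). a \<in> {0.9<..<1.1} \<and> b \<in> {0.9<..<1.1})"
  proof (rule ext)
    fix p show "Emin_feasible ell \<mu> p = (case p of (a, b) \<Rightarrow> a \<in> {0.9<..<1.1} \<and> b \<in> {0.9<..<1.1})"
      using Emin_feasible_iff [OF ell \<mu>, of "fst p" "snd p"] by (simp add: case_prod_beta)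
  qed
  show ?thesis
    unfolding Emin_solution_def feas
  proof (rule is_arg_min_scale [THEN fun_cong])
    show "0 < 2 * real m * real ell" using m ell by simp
    fix x :: "real \<times> real" assume x: "case x of (a, b) \<Rightarrow> a \<in> {0.9<..<1.1} \<and> b \<in> {0.9<..<1.1}"
    obtain a b where ab: "x = (a, b)" by (cases x)
    show "(case x of (a, b) \<Rightarrow> zigzag_energy v2 v3 m ell a b \<mu>) = 2 * real m * real ell *
        (case x of (a, b) \<Rightarrow> atom_energy v2 v3 ((cos (pi / (2 * real ell)))\<^sup>2) \<mu> a b)"
      using x zigzag_energy_eq [OF m ell _ _ \<mu>, of a b v2 v3] unfolding ab prod.case by blast
  qed
qed

section \<open>The unstretched period\<close>

text \<open>
  With \<open>sin \<alpha> = 2 sin (\<alpha>/2) cos (\<alpha>/2)\<close> the equation \<open>\<beta>(\<alpha>, \<gamma>) = \<alpha>\<close> becomes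
  \<open>2 c cos (\<alpha>/2) = 1\<close>.
\<close>

lemma cos_alpha_ch:
  assumes ell: "4 \<le> ell"
  defines "c \<equiv> cos (pi / (2 * real ell))"
  shows "alpha_ch ell \<in> {pi/2<..<pi}" "cos (alpha_ch ell) = 1 / (2 * c\<^sup>2) - 1"
proof -
  define x where "x = 1 / (2 * c\<^sup>2) - 1"
  define \<alpha>0 where "\<alpha>0 = arccos x"
  note c = half_angle_bounds(3-5) [OF ell, folded c_def]
  have "1 / (2 * 1) \<le> 1 / (2 * c\<^sup>2)" using c by (intro divide_left_mono) auto
  moreover have "1 / (2 * c\<^sup>2) \<le> 1 / (2 * 0.85)"
    using c(2) by (intro divide_left_mono) (use c in auto)
  ultimately have x: "-0.5 \<le> x" "x < -0.4" by (simp_all add: x_def)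
  have half: "sin (tube_angle ell / 2) = c"
  proof -
    have eq: "tube_angle ell / 2 = pi/2 - pi / (2 * real ell)"
      using ell by (simp add: tube_angle_def field_simps)
    show ?thesis unfolding eq c_def by (simp add: sin_diff)
  qed
  have fixed_iff: "beta \<alpha> (tube_angle ell) = \<alpha> \<longleftrightarrow> cos \<alpha> = x" if \<alpha>: "\<alpha> \<in> {0<..<pi}" for \<alpha>
  proof -
    have pos: "0 < sin (\<alpha>/2)" "0 < cos (\<alpha>/2)"
      using \<alpha> by (auto intro!: sin_gt_zero cos_gt_zero)
    have "\<bar>sin \<alpha> * c\<bar> \<le> 1" unfolding abs_mult
      using c abs_sin_le_one by (intro mult_le_one) (auto simp: abs_square_le_1)
    then have rng: "-1 \<le> sin \<alpha> * c" "sin \<alpha> * c \<le> 1" by (auto simp: abs_le_iff)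
    have "beta \<alpha> (tube_angle ell) = \<alpha> \<longleftrightarrow> arcsin (sin \<alpha> * c) = \<alpha>/2"
      unfolding beta_def half by auto
    also have "\<dots> \<longleftrightarrow> sin \<alpha> * c = sin (\<alpha>/2)"
    proof
      show "sin \<alpha> * c = sin (\<alpha>/2)" if "arcsin (sin \<alpha> * c) = \<alpha>/2"
        using sin_arcsin [OF rng] that by simp
      show "arcsin (sin \<alpha> * c) = \<alpha>/2" if "sin \<alpha> * c = sin (\<alpha>/2)"
        unfolding that using \<alpha> by (intro arcsin_sin) auto
    qed
    also have "sin \<alpha> = 2 * sin (\<alpha>/2) * cos (\<alpha>/2)" using sin_double [of "\<alpha>/2"] by simp
    also have "2 * sin (\<alpha>/2) * cos (\<alpha>/2) * c = sin (\<alpha>/2) \<longleftrightarrow> cos (\<alpha>/2) = 1 / (2 * c)"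
      using pos c(1) by (auto simp: field_simps)
    also have "\<dots> \<longleftrightarrow> (cos (\<alpha>/2))\<^sup>2 = (1 / (2 * c))\<^sup>2"
      using pos c(1) by (simp add: power2_eq_iff_nonneg)
    also have "\<dots> \<longleftrightarrow> cos \<alpha> = x"
      using cos_double_cos [of "\<alpha>/2"] by (auto simp: x_def power_divide power_mult_distrib)
    finally show ?thesis .
  qed
  have dom: "\<alpha> \<in> {0<..<pi}" if "\<alpha> \<in> {arccos (-0.4)<..<arccos (-0.6)}" for \<alpha>
    using that arccos_lbound [of "-0.4"] arccos_ubound [of "-0.6"] by auto
  have \<alpha>0: "\<alpha>0 \<in> {arccos (-0.4)<..<arccos (-0.6)}" "cos \<alpha>0 = x"
    using x by (auto simp: \<alpha>0_def intro!: arccos_less_arccos)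
  have "alpha_ch ell = \<alpha>0"
    unfolding alpha_ch_def
  proof (rule the_equality)
    show "\<alpha>0 \<in> {arccos (-0.4)<..<arccos (-0.6)} \<and> beta \<alpha>0 (tube_angle ell) = \<alpha>0"
      using \<alpha>0 fixed_iff [OF dom] by blast
    fix \<alpha> assume "\<alpha> \<in> {arccos (-0.4)<..<arccos (-0.6)} \<and> beta \<alpha> (tube_angle ell) = \<alpha>"
    then have "\<alpha> \<in> {0<..<pi}" "cos \<alpha> = x" using dom fixed_iff by blast+
    then show "\<alpha> = \<alpha>0" using arccos_cos [of \<alpha>] by (simp add: \<alpha>0_def)
  qed
  then show "cos (alpha_ch ell) = 1 / (2 * c\<^sup>2) - 1" using \<alpha>0 by (simp add: x_def)
  have "arccos 0 < \<alpha>0" unfolding \<alpha>0_def using x by (intro arccos_less_arccos) auto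
  then show "alpha_ch ell \<in> {pi/2<..<pi}"
    using \<open>alpha_ch ell = \<alpha>0\<close> dom [OF \<alpha>0(1)] by simp
qed

text \<open>
  The lower bound tends to \<open>3\<close> as \<open>ell\<close> grows, uniformly in the number \<open>m\<close> of periods.
\<close>

lemma mu_us_bounds:
  assumes A: "unstretched_interval v2 v3 A N" and m: "1 \<le> m" and ell: "4 \<le> ell" "N < ell"
  shows "4 - 1 / (cos (pi / (2 * real ell)))\<^sup>2 < mu_us v2 v3 m A ell" "mu_us v2 v3 m A ell < 3"
proof -
  define \<alpha> where "\<alpha> = alpha_us v2 v3 m A ell"
  have "3 < ell" using ell by simp
  then have "\<alpha> \<in> {alpha_ch ell<..<alpha_ru}"
    using A [unfolded unstretched_interval_def, THEN conjunct2, THEN conjunct2, rule_format, OF m _ ell(2)]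
    by (simp add: \<alpha>_def)
  then have \<alpha>: "alpha_ch ell < \<alpha>" "\<alpha> < 2*pi/3" by (simp_all add: alpha_ru_def)
  note ch = cos_alpha_ch [OF ell(1)]
  have ch0: "0 \<le> alpha_ch ell" using ch(1) pi_gt_zero by auto
  have "cos \<alpha> < cos (alpha_ch ell)"
    using \<alpha> ch0 pi_gt_zero by (intro cos_monotone_0_pi) linarith+
  moreover have "cos (2*pi/3) < cos \<alpha>"
    using \<alpha> ch0 pi_gt_zero by (intro cos_monotone_0_pi) linarith+
  ultimately show "4 - 1 / (cos (pi / (2 * real ell)))\<^sup>2 < mu_us v2 v3 m A ell" "mu_us v2 v3 m A ell < 3"
    unfolding mu_us_def \<alpha>_def [symmetric] ch(2) cos_120 by simp_all
qed

section \<open>Minimizers at periods close to the unstretched one\<close>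

theorem theorem3p2:
  fixes v2 v3 :: "real \<Rightarrow> real" and A :: "real set" and N :: nat
  assumes "two_body_potential v2" and "three_body_potential v3"
    and "unstretched_interval v2 v3 A N"
  shows "\<exists>ell0>3. \<forall>ell\<ge>ell0. \<exists>a b :: real.
           {a<..<b} \<subseteq> {2.6<..<3.1} \<and>
           (\<forall>m\<ge>1. mu_us v2 v3 m A ell \<in> {a<..<b} \<and>
              (\<forall>\<mu>\<in>{a<..<b}. \<exists>!p. Emin_solution v2 v3 m ell \<mu> p))"
proof -
  obtain \<delta> where \<delta>: "0 < \<delta>" "\<delta> \<le> 1/60"
    and unique: "\<And>\<mu> K. \<lbrakk>\<bar>\<mu> - 3\<bar> < \<delta>; 1 - \<delta> < K; K \<le> 1\<rbrakk> \<Longrightarrow>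
       \<exists>!p. is_arg_min (\<lambda>(a, b). atom_energy v2 v3 K \<mu> a b)
              (\<lambda>(a, b). a \<in> {0.9<..<1.1} \<and> b \<in> {0.9<..<1.1}) p"
    by (rule atom_energy_unique_minimizer [OF assms(1,2)]) (rule that)
  define K where "K ell = (cos (pi / (2 * real ell)))\<^sup>2" for ell :: nat
  have "K \<longlonglongrightarrow> 1" unfolding K_def by real_asymp
  then have "\<forall>\<^sub>F ell in sequentially. 1 - \<delta>/2 < K ell"
    using \<delta> by (intro order_tendstoD(1)) auto
  then obtain n where n: "\<And>ell. n \<le> ell \<Longrightarrow> 1 - \<delta>/2 < K ell"
    unfolding eventually_sequentially by blast
  define ell0 where "ell0 = max n (max 4 (N + 1))"
  have main: "{3 - \<delta><..<3 + \<delta>} \<subseteq> {2.6<..<3.1} \<and>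
      (\<forall>m\<ge>1. mu_us v2 v3 m A ell \<in> {3 - \<delta><..<3 + \<delta>} \<and>
        (\<forall>\<mu>\<in>{3 - \<delta><..<3 + \<delta>}. \<exists>!p. Emin_solution v2 v3 m ell \<mu> p))"
    if "ell0 \<le> ell" for ell
  proof (intro conjI allI impI ballI)
    have ell: "n \<le> ell" "4 \<le> ell" "N < ell" using that by (auto simp: ell0_def)
    have K: "1 - \<delta>/2 < K ell" "K ell \<le> 1"
      using n [OF ell(1)] by (auto simp: K_def abs_square_le_1)
    show sub: "{3 - \<delta><..<3 + \<delta>} \<subseteq> {2.6<..<3.1}" using \<delta> by auto
    fix m :: nat assume m: "1 \<le> m"
    have "1 / K ell < 1 + \<delta>"
    proof -
      have "0 < \<delta>/2 * (1 - \<delta>)" using \<delta> by (intro mult_pos_pos) auto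
      then have "1 < (1 + \<delta>) * (1 - \<delta>/2)" by (simp add: algebra_simps)
      also have "\<dots> < (1 + \<delta>) * K ell" using K \<delta> by (intro mult_strict_left_mono) auto
      finally show ?thesis using K \<delta> by (simp add: pos_divide_less_eq)
    qed
    moreover have "4 - 1 / K ell < mu_us v2 v3 m A ell" "mu_us v2 v3 m A ell < 3"
      unfolding K_def by (rule mu_us_bounds [OF assms(3) m ell(2,3)])+
    ultimately show "mu_us v2 v3 m A ell \<in> {3 - \<delta><..<3 + \<delta>}"
      using \<delta>(1) unfolding greaterThanLessThan_iff by linarith
    fix \<mu> assume \<mu>: "\<mu> \<in> {3 - \<delta><..<3 + \<delta>}"
    then have \<mu>_range: "\<mu> \<in> {2.6<..<3.1}" using sub by blast
    have "\<bar>\<mu> - 3\<bar> < \<delta>" using \<mu> by (auto simp: abs_less_iff)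
    moreover have "1 - \<delta> < K ell" using K \<delta> by simp
    ultimately have "\<exists>!p. is_arg_min (\<lambda>(a, b). atom_energy v2 v3 (K ell) \<mu> a b)
              (\<lambda>(a, b). a \<in> {0.9<..<1.1} \<and> b \<in> {0.9<..<1.1}) p"
      using K(2) by (rule unique)
    then show "\<exists>!p. Emin_solution v2 v3 m ell \<mu> p"
      unfolding Emin_solution_iff [OF m ell(2) \<mu>_range] K_def .
  qed
  show ?thesis
  proof (rule exI [of _ ell0], intro conjI allI impI)
    show "3 < ell0" by (simp add: ell0_def)
  qed (rule exI, rule exI, erule main)
qed

end
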